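(* Let $C>0$ and let $\mathcal{G}_C=\{(K,\tilde K): J(K,\tilde K)\le C\}$. Suppose there is $C_n>0$ such that $\|x_0\|\le C_n$ for all $x_0\sim\mathcal{D}$ (i.e. for all $x_0$ in the support of $\mathcal D$). Then there exist a local radius $\rho>0$, a Lipschitz parameter $\lambda>0$ and a Lipschitz gradient parameter $L>0$, all depending only on $(A,B,Q,R,\Sigma,\gamma,x^*,C,C_n)$, such that for every $(K,\tilde K)\in\mathcal{G}_C$ and every $(K',\tilde K')$ with $\|(K',\tilde K')-(K,\tilde K)\|\le\rho$, $$|J(K',\tilde K')-J(K,\tilde K)|\le\lambda\,\|(K',\tilde K')-(K,\tilde K)\|,$$ $$|J(K',\tilde K';x_0)-J(K,\tilde K;x_0)|\le\lambda\,\|(K',\tilde K')-(K,\tilde K)\|\quad\text{for all } x_0\sim\mathcal{D},$$ $$\|\nabla J(K',\tilde K')-\nabla J(K,\tilde K)\|\le L\,\|(K',\tilde K')-(K,\tilde K)\|.$$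
   Context: Setting (discounted LQR tracking). Fix integers $n,k\ge 1$, matrices $A\in\mathbb{R}^{n\times n}$, $B\in\mathbb{R}^{n\times k}$ with $(A,B)$ controllable, symmetric positive definite matrices $Q\in\mathbb{R}^{n\times n}$, $R\in\mathbb{R}^{k\times k}$, $\Sigma\in\mathbb{R}^{n\times n}$, a discount factor $0<\gamma<1$ and a target $x^*\in\mathbb{R}^n$. The initial state $x_0$ has distribution $\mathcal{D}$ on $\mathbb{R}^n$ with $\mathbb{E}[x_0]=0$ and $\mathbb{E}[x_0x_0^\top]=\Sigma$. A policy is a pair $(K,\tilde K)$ with $K,\tilde K\in\mathbb{R}^{k\times n}$; it generates $x_{t+1}=Ax_t+Bu_t$, $u_t=Kx_t+\tilde Kx^*$. For a given initial state, the sample cost is $$J(K,\tilde K;x_0)=\sum_{t=0}^\infty\gamma^t\big((x_t-x^* )^\top Q(x_t-x^* )+u_t^\top Ru_t\big),$$ and $J(K,\tilde K)=\mathbb{E}_{x_0\sim\mathcal{D}}[J(K,\tilde K;x_0)]\in[0,\infty]$. $\nabla J$ is the gradient with respect to all $2nk$ entries of $(K,\tilde K)$; $\|\cdot\|$ is the Euclidean (Frobenius) norm. *)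

theory Defs
  imports "HOL-Probability.Probability"
begin

definition pos_def :: "real^'n^'n \<Rightarrow> bool" where
  "pos_def M \<longleftrightarrow> transpose M = M \<and> (\<forall>x. x \<noteq> 0 \<longrightarrow> x \<bullet> (M *v x) > 0)"

primrec open_loop ::
  "real^'n^'n \<Rightarrow> real^'k^'n \<Rightarrow> (nat \<Rightarrow> real^'k) \<Rightarrow> real^'n \<Rightarrow> nat \<Rightarrow> real^'n" where
  "open_loop A B u a 0 = a"
| "open_loop A B u a (Suc t) = A *v open_loop A B u a t + B *v u t"

definition controllable :: "real^'n^'n \<Rightarrow> real^'k^'n \<Rightarrow> bool" where
  "controllable A B \<longleftrightarrow> (\<forall>a b. \<exists>u T. open_loop A B u a T = b)"

type_synonym ('n, 'k) policy = "(real^'n^'k) \<times> (real^'n^'k)"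

definition control ::
  "real^'n \<Rightarrow> ('n::finite, 'k::finite) policy \<Rightarrow> real^'n \<Rightarrow> real^'k" where
  "control xstar \<theta> x = fst \<theta> *v x + snd \<theta> *v xstar"

primrec state ::
  "real^'n^'n \<Rightarrow> real^'k^'n \<Rightarrow> real^'n \<Rightarrow> ('n::finite, 'k::finite) policy \<Rightarrow> real^'n
    \<Rightarrow> nat \<Rightarrow> real^'n" where
  "state A B xstar \<theta> x0 0 = x0"
| "state A B xstar \<theta> x0 (Suc t) =
     A *v state A B xstar \<theta> x0 t + B *v control xstar \<theta> (state A B xstar \<theta> x0 t)"

definition stage_cost ::
  "real^'n^'n \<Rightarrow> real^'k^'k \<Rightarrow> real^'n \<Rightarrow> real^'n \<Rightarrow> real^'k \<Rightarrow> real" where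
  "stage_cost Q R xstar x u = (x - xstar) \<bullet> (Q *v (x - xstar)) + u \<bullet> (R *v u)"

(* The coercion ennreal truncates negative reals to 0; this is harmless here, because the
   summands are nonnegative whenever Q and R are positive definite and \<gamma> \<ge> 0. *)
definition sample_cost ::
  "real^'n^'n \<Rightarrow> real^'k^'n \<Rightarrow> real^'n^'n \<Rightarrow> real^'k^'k \<Rightarrow> real \<Rightarrow> real^'n
    \<Rightarrow> ('n::finite, 'k::finite) policy \<Rightarrow> real^'n \<Rightarrow> ennreal" where
  "sample_cost A B Q R \<gamma> xstar \<theta> x0 =
     (\<Sum>t. ennreal (\<gamma> ^ t * stage_cost Q R xstar (state A B xstar \<theta> x0 t)
                                (control xstar \<theta> (state A B xstar \<theta> x0 t))))"

definition expected_cost ::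
  "real^'n^'n \<Rightarrow> real^'k^'n \<Rightarrow> real^'n^'n \<Rightarrow> real^'k^'k \<Rightarrow> real \<Rightarrow> real^'n
    \<Rightarrow> (real^'n) measure \<Rightarrow> ('n::finite, 'k::finite) policy \<Rightarrow> ennreal" where
  "expected_cost A B Q R \<gamma> xstar D \<theta> = (\<integral>\<^sup>+ x0. sample_cost A B Q R \<gamma> xstar \<theta> x0 \<partial>D)"

definition sublevel ::
  "real^'n^'n \<Rightarrow> real^'k^'n \<Rightarrow> real^'n^'n \<Rightarrow> real^'k^'k \<Rightarrow> real \<Rightarrow> real^'n
    \<Rightarrow> (real^'n) measure \<Rightarrow> real \<Rightarrow> ('n::finite, 'k::finite) policy set" where
  "sublevel A B Q R \<gamma> xstar D C = {\<theta>. expected_cost A B Q R \<gamma> xstar D \<theta> \<le> ennreal C}"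

definition initial_distribution :: "real^'n^'n \<Rightarrow> (real^'n) measure \<Rightarrow> bool" where
  "initial_distribution \<Sigma> D \<longleftrightarrow>
     prob_space D \<and> sets D = sets borel \<and>
     has_bochner_integral D (\<lambda>x. x) 0 \<and>
     has_bochner_integral D (\<lambda>x. \<chi> i j. x $ i * x $ j) \<Sigma>"

definition msupport :: "'a::topological_space measure \<Rightarrow> 'a set" where
  "msupport M = {x. \<forall>U. open U \<and> x \<in> U \<longrightarrow> emeasure M U > 0}"

end

theory Submission
  imports Defs
begin

text \<open>
  Both differences of costs and the difference of gradients are controlled by one estimate: a
  first-order expansion of the sample cost in the policy increment \<open>h\<close> whose remainder is at most
  \<open>K * (norm h)\<^sup>2 * (norm (x0, 1))\<^sup>2\<close>, with \<open>K\<close> uniform over a neighbourhood of the sublevel set.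

  Adjoining a constant coordinate to the state and scaling each step by \<open>sqrt \<gamma>\<close>, the sample cost
  becomes a sum of quadratic forms along a linear system that depends affinely on the policy. If
  a policy makes this system decay exponentially, then so do all policies within a radius that
  depends only on the decay constants (\<open>exponential_stability_perturbation\<close>), and each order of the
  expansion of the trajectory solves the same linear recursion, driven by the preceding order
  (\<open>forced_response_bound\<close>). This gives the expansion of the cost (\<open>uniform_first_order_expansion\<close>).

  Uniform decay on the sublevel set comes from the cost itself. As \<open>x0\<close> has mean zero and positive
  definite covariance, the expected cost dominates the sum of the squared operator norms of the maps
  from the initial state to the outputs (\<open>linear_image_second_moment\<close>). Hence the trajectories are
  square summable with a constant depending only on the data, and a Lyapunov function turns this into a decay rate
  (\<open>exponential_stability_of_square_summable\<close>, \<open>sublevel_uniformly_stable\<close>).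

  Finally, the expansion is integrated over the initial state (\<open>taylor_expansion_integral\<close>), where
  \<open>(norm (x0, 1))\<^sup>2\<close> has the mean \<open>1 + trace \<Sigma>\<close>. An expansion with a uniform quadratic remainder at
  all base points has a Lipschitz gradient (\<open>gradient_difference_of_quadratic_remainder\<close>).
\<close>

section \<open>First-order expansions with quadratic remainder\<close>

text \<open>A Taylor expansion whose remainder has an integrable majorant may be integrated.
  The differential inherits measurability in the sample point \<open>x\<close> from the functions \<open>\<phi> y\<close>, because
  on a basis vector it is a pointwise limit of their difference quotients, and the quotient at full step length, together with the majorant, bounds it
  by an integrable function.\<close>

lemma taylor_expansion_integral:
  fixes \<phi> :: "'p::euclidean_space \<Rightarrow> 'a \<Rightarrow> real"
  assumes r: "0 < r" and m: "integrable M m"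
    and \<phi>: "\<And>y. y \<in> cball \<theta> r \<Longrightarrow> integrable M (\<phi> y)"
    and lin: "\<And>x. linear (D x)"
    and taylor: "\<And>x y. y \<in> cball \<theta> r \<Longrightarrow> \<bar>\<phi> y x - \<phi> \<theta> x - D x (y - \<theta>)\<bar> \<le> K * (norm (y - \<theta>))\<^sup>2 * m x"
  obtains g where "\<And>y. y \<in> cball \<theta> r \<Longrightarrow>
    \<bar>integral\<^sup>L M (\<phi> y) - integral\<^sup>L M (\<phi> \<theta>) - g \<bullet> (y - \<theta>)\<bar> \<le> K * (norm (y - \<theta>))\<^sup>2 * integral\<^sup>L M m"
proof -
  have \<theta>: "\<theta> \<in> cball \<theta> r" using r by simp
  have int: "integrable M (\<lambda>x. D x e)" if e: "e \<in> Basis" for e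
  proof -
    define q where "q n = r / real (Suc n)" for n
    have q: "0 < q n" "q n \<le> r" for n using r by (auto simp: q_def field_simps)
    have q0: "q \<longlonglongrightarrow> 0"
      unfolding q_def using LIMSEQ_inverse_real_of_nat[THEN tendsto_mult_left, of r]
      by (simp add: divide_inverse)
    have in_ball: "\<theta> + q n *\<^sub>R e \<in> cball \<theta> r" for n
      using q[of n] e by (simp add: dist_norm)
    have est: "\<bar>\<phi> (\<theta> + q n *\<^sub>R e) x - \<phi> \<theta> x - q n * D x e\<bar> \<le> K * (q n)\<^sup>2 * m x" for n x
      using taylor[OF in_ball[of n], of x] e by (simp add: linear_scale[OF lin])
    have meas: "(\<lambda>x. D x e) \<in> borel_measurable M"
    proof (rule borel_measurable_LIMSEQ_real)
      show "(\<lambda>x. (\<phi> (\<theta> + q n *\<^sub>R e) x - \<phi> \<theta> x) / q n) \<in> borel_measurable M" for n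
        using \<phi>[OF in_ball, of n] \<phi>[OF \<theta>] by (auto intro!: borel_measurable_divide borel_measurable_diff)
      show "(\<lambda>n. (\<phi> (\<theta> + q n *\<^sub>R e) x - \<phi> \<theta> x) / q n) \<longlonglongrightarrow> D x e" for x
      proof (rule LIM_zero_cancel, rule Lim_null_comparison)
        show "\<forall>\<^sub>F n in sequentially. norm ((\<phi> (\<theta> + q n *\<^sub>R e) x - \<phi> \<theta> x) / q n - D x e) \<le> K * q n * m x"
        proof (rule always_eventually, rule allI)
          fix n
          have "norm ((\<phi> (\<theta> + q n *\<^sub>R e) x - \<phi> \<theta> x) / q n - D x e)
             = \<bar>(\<phi> (\<theta> + q n *\<^sub>R e) x - \<phi> \<theta> x - q n * D x e) / q n\<bar>"
            using q(1)[of n] by (simp add: diff_divide_distrib)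
          also have "\<dots> = \<bar>\<phi> (\<theta> + q n *\<^sub>R e) x - \<phi> \<theta> x - q n * D x e\<bar> / q n"
            using q(1)[of n] by simp
          also have "\<dots> \<le> K * (q n)\<^sup>2 * m x / q n"
            by (rule divide_right_mono[OF est]) (use q(1)[of n] in simp)
          finally show "norm ((\<phi> (\<theta> + q n *\<^sub>R e) x - \<phi> \<theta> x) / q n - D x e) \<le> K * q n * m x"
            using q(1)[of n] by (simp add: power2_eq_square)
        qed
        show "(\<lambda>n. K * q n * m x) \<longlonglongrightarrow> 0"
          using tendsto_mult_right[OF tendsto_mult_left[OF q0, of K], of "m x"] by simp
      qed
    qed
    show ?thesis
    proof (rule Bochner_Integration.integrable_bound[OF _ meas])
      show "integrable M (\<lambda>x. (\<bar>\<phi> (\<theta> + q 0 *\<^sub>R e) x\<bar> + \<bar>\<phi> \<theta> x\<bar> + K * (q 0)\<^sup>2 * m x) / q 0)"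
        using \<phi>[OF in_ball, of 0] \<phi>[OF \<theta>] m by auto
      show "AE x in M. norm (D x e) \<le> norm ((\<bar>\<phi> (\<theta> + q 0 *\<^sub>R e) x\<bar> + \<bar>\<phi> \<theta> x\<bar> + K * (q 0)\<^sup>2 * m x) / q 0)"
      proof (rule AE_I2)
        fix x
        have "q 0 * \<bar>D x e\<bar> = \<bar>q 0 * D x e\<bar>" using q(1)[of 0] by (simp add: abs_mult)
        also have "\<dots> \<le> \<bar>\<phi> (\<theta> + q 0 *\<^sub>R e) x\<bar> + \<bar>\<phi> \<theta> x\<bar> + K * (q 0)\<^sup>2 * m x"
          using est[of 0 x] by linarith
        finally have "\<bar>D x e\<bar> \<le> (\<bar>\<phi> (\<theta> + q 0 *\<^sub>R e) x\<bar> + \<bar>\<phi> \<theta> x\<bar> + K * (q 0)\<^sup>2 * m x) / q 0"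
          using q(1)[of 0] by (simp add: field_simps)
        then show "norm (D x e) \<le> norm ((\<bar>\<phi> (\<theta> + q 0 *\<^sub>R e) x\<bar> + \<bar>\<phi> \<theta> x\<bar> + K * (q 0)\<^sup>2 * m x) / q 0)"
          unfolding real_norm_def by (rule order_trans[OF _ abs_ge_self])
      qed
    qed
  qed
  define g where "g = (\<Sum>e\<in>Basis. (\<integral>x. D x e \<partial>M) *\<^sub>R e)"
  have D_eq: "D x h = (\<Sum>e\<in>Basis. (h \<bullet> e) * D x e)" for x h
    using linear_sum[OF lin, of x "\<lambda>e. (h \<bullet> e) *\<^sub>R e" Basis] 
    by (simp add: euclidean_representation linear_scale[OF lin])
  have D_int: "integrable M (\<lambda>x. D x h)" for h
    unfolding D_eq[of _ h] using int by auto
  have D_val: "(\<integral>x. D x h \<partial>M) = g \<bullet> h" for h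
    unfolding D_eq[of _ h] g_def using int by (simp add: inner_sum_left inner_commute[of h] mult.commute)
  show thesis
  proof (rule that)
    fix y assume y: "y \<in> cball \<theta> r"
    have "integral\<^sup>L M (\<phi> y) - integral\<^sup>L M (\<phi> \<theta>) - g \<bullet> (y - \<theta>) = (\<integral>x. \<phi> y x - \<phi> \<theta> x - D x (y - \<theta>) \<partial>M)"
      using \<phi>[OF y] \<phi>[OF \<theta>] D_int[of "y - \<theta>"] by (simp add: D_val)
    also have "\<bar>\<dots>\<bar> \<le> (\<integral>x. \<bar>\<phi> y x - \<phi> \<theta> x - D x (y - \<theta>)\<bar> \<partial>M)" by (rule integral_abs_bound)
    also have "\<dots> \<le> (\<integral>x. K * (norm (y - \<theta>))\<^sup>2 * m x \<partial>M)"
      using \<phi>[OF y] \<phi>[OF \<theta>] D_int[of "y - \<theta>"] m by (intro integral_mono taylor[OF y]) auto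
    finally show "\<bar>integral\<^sup>L M (\<phi> y) - integral\<^sup>L M (\<phi> \<theta>) - g \<bullet> (y - \<theta>)\<bar>
        \<le> K * (norm (y - \<theta>))\<^sup>2 * integral\<^sup>L M m" by simp
  qed
qed

lemma GDERIV_of_quadratic_remainder:
  fixes f :: "'p::real_inner \<Rightarrow> real"
  assumes r: "0 < r"
    and rem: "\<And>y. y \<in> cball x r \<Longrightarrow> \<bar>f y - f x - g \<bullet> (y - x)\<bar> \<le> K * (norm (y - x))\<^sup>2"
  shows "GDERIV f x :> g"
  unfolding gderiv_def
proof (rule has_derivativeI_sandwich[OF r])
  show "bounded_linear (\<lambda>h. h \<bullet> g)" by (rule bounded_linear_inner_left)
  show "norm (f y - f x - (y - x) \<bullet> g) / norm (y - x) \<le> K * norm (y - x)"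
    if "y \<noteq> x" "dist y x < r" for y
    using rem[of y] that
    by (simp add: dist_commute inner_commute power2_eq_square field_simps)
  have "((\<lambda>y. K * norm (y - x)) \<longlongrightarrow> K * norm (x - x)) (at x)" by (intro tendsto_intros)
  then show "((\<lambda>y. K * norm (y - x)) \<longlongrightarrow> 0) (at x)" by simp
qed

text \<open>First-order expansions at two base points with the same quadratic remainder force the two
  gradients to be close, which replaces the computation of a second derivative. Expand \<open>f\<close> at
  \<open>x' + k\<close> once around \<open>x'\<close> and once around \<open>x\<close>, with \<open>norm k = norm (x' - x)\<close>: the function
  values cancel against the expansion of \<open>f x'\<close> around \<open>x\<close>, and \<open>(g' - g) \<bullet> k\<close> is left with
  error \<open>(1 + 4 + 1) * K * (norm k)\<^sup>2\<close>. Choosing \<open>k\<close> parallel to \<open>g' - g\<close> gives the claim.\<close>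

lemma gradient_difference_of_quadratic_remainder:
  fixes f :: "'p::real_inner \<Rightarrow> real"
  assumes d: "norm (x' - x) \<le> r / 2"
    and rem: "\<And>y. y \<in> cball x r \<Longrightarrow> \<bar>f y - f x - g \<bullet> (y - x)\<bar> \<le> K * (norm (y - x))\<^sup>2"
    and rem': "\<And>y. y \<in> cball x' (r / 2) \<Longrightarrow> \<bar>f y - f x' - g' \<bullet> (y - x')\<bar> \<le> K * (norm (y - x'))\<^sup>2"
    and K: "0 \<le> K" and r: "0 < r"
  shows "norm (g' - g) \<le> 6 * K * norm (x' - x)"
proof (cases "g' = g \<or> x' = x")
  case True
  have "g' = g" if "x' = x"
  proof -
    have "GDERIV f x :> g'"
      using GDERIV_of_quadratic_remainder[of "r / 2" x' f g' K] rem' r that by simp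
    with GDERIV_of_quadratic_remainder[of r x f g K] rem r
    have "(\<lambda>h. h \<bullet> g') = (\<lambda>h. h \<bullet> g)"
      unfolding gderiv_def by (intro has_derivative_unique[of f _ x]) auto
    then show ?thesis using vector_eq_ldot[of g' g] by meson
  qed
  with True K show ?thesis by auto
next
  case False
  define \<delta> where "\<delta> = norm (x' - x)"
  \<comment> \<open>a test direction of the same length as \<open>x' - x\<close>, so that all three remainders are comparable\<close>
  define k where "k = \<delta> *\<^sub>R sgn (g' - g)"
  have \<delta>: "0 < \<delta>" using False by (simp add: \<delta>_def)
  have k: "norm k = \<delta>" using False \<delta> by (simp add: k_def norm_sgn)
  have gk: "(g' - g) \<bullet> k = norm (g' - g) * \<delta>"
    using False by (simp add: k_def sgn_div_norm power2_norm_eq_inner[symmetric] power2_eq_square)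
  have n2: "norm (x' + k - x) \<le> 2 * \<delta>"
    using norm_triangle_ineq[of "x' - x" k] k by (simp add: \<delta>_def algebra_simps)
  have i1: "\<bar>f (x' + k) - f x' - g' \<bullet> k\<bar> \<le> K * \<delta>\<^sup>2"
    using rem'[of "x' + k"] k d by (simp add: \<delta>_def dist_norm)
  have "\<bar>f (x' + k) - f x - g \<bullet> (x' + k - x)\<bar> \<le> K * (norm (x' + k - x))\<^sup>2"
    using rem[of "x' + k"] n2 d by (simp add: \<delta>_def dist_norm norm_minus_commute)
  also have "\<dots> \<le> K * (2 * \<delta>)\<^sup>2" using n2 K by (intro mult_left_mono power_mono) auto
  finally have i2: "\<bar>f (x' + k) - f x - g \<bullet> (x' + k - x)\<bar> \<le> 4 * K * \<delta>\<^sup>2"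
    by (simp add: power2_eq_square)
  have i3: "\<bar>f x' - f x - g \<bullet> (x' - x)\<bar> \<le> K * \<delta>\<^sup>2"
    using rem[of x'] d r by (simp add: \<delta>_def dist_norm norm_minus_commute)
  have "norm (g' - g) * \<delta> = g' \<bullet> k - (g \<bullet> (x' + k - x) - g \<bullet> (x' - x))"
    unfolding gk[symmetric] by (simp add: algebra_simps)
  also have "\<dots> \<le> 6 * K * \<delta>\<^sup>2" using i1 i2 i3 by linarith
  finally have "norm (g' - g) * \<delta> \<le> (6 * K * \<delta>) * \<delta>" by (simp add: power2_eq_square)
  then show ?thesis using \<delta> unfolding \<delta>_def by (rule mult_right_le_imp_le)
qed

section \<open>Parametrised linear systems with quadratic cost\<close>

lemma abs_suminf_geometric_le:
  fixes f :: "nat \<Rightarrow> real"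
  assumes "0 \<le> \<beta>" "\<beta> < 1" and f: "\<And>t. \<bar>f t\<bar> \<le> M * \<beta> ^ t"
  shows "summable f" and "\<bar>suminf f\<bar> \<le> M / (1 - \<beta>)"
proof -
  have s: "(\<lambda>t. M * \<beta> ^ t) sums (M / (1 - \<beta>))"
    using sums_mult[OF geometric_sums[of \<beta>], of M] assms(1,2) by simp
  show "summable f"
    by (rule summable_comparison_test[OF _ sums_summable[OF s]]) (use f in auto)
  show "\<bar>suminf f\<bar> \<le> M / (1 - \<beta>)"
    using norm_suminf_le[of f "\<lambda>t. M * \<beta> ^ t"] f sums_summable[OF s] sums_unique[OF s] by simp
qed

text \<open>A linear system \<open>z \<mapsto> G0 z + H \<theta> z\<close> with output \<open>P0 z + N \<theta> z\<close> whose dependence on the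
  parameter \<open>\<theta>\<close> is affine, and the quadratic form \<open>b\<close> of the outputs summed along the
  trajectory. A discount factor is to be absorbed into \<open>G0\<close> and \<open>H\<close>.\<close>

locale bilinear_feedback =
  fixes G0 :: "'z::real_normed_vector \<Rightarrow> 'z" and H :: "'p::real_normed_vector \<Rightarrow> 'z \<Rightarrow> 'z"
    and P0 :: "'z \<Rightarrow> 'w::real_normed_vector" and N :: "'p \<Rightarrow> 'z \<Rightarrow> 'w"
    and b :: "'w \<Rightarrow> 'w \<Rightarrow> real"
  assumes G0: "linear G0" and H: "bounded_bilinear H"
    and P0: "linear P0" and N: "bounded_bilinear N"
    and b: "bounded_bilinear b" and b_sym: "b u v = b v u"
begin

definition step :: "'p \<Rightarrow> 'z \<Rightarrow> 'z" where "step \<theta> z = G0 z + H \<theta> z"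
definition out :: "'p \<Rightarrow> 'z \<Rightarrow> 'w" where "out \<theta> z = P0 z + N \<theta> z"
definition traj :: "'p \<Rightarrow> 'z \<Rightarrow> nat \<Rightarrow> 'z" where "traj \<theta> z t = (step \<theta> ^^ t) z"
definition obs :: "'p \<Rightarrow> 'z \<Rightarrow> nat \<Rightarrow> 'w" where "obs \<theta> z t = out \<theta> (traj \<theta> z t)"
definition cost :: "'p \<Rightarrow> 'z \<Rightarrow> real" where
  "cost \<theta> z = (\<Sum>t. b (obs \<theta> z t) (obs \<theta> z t))"

text \<open>The derivatives of trajectory, output and cost with respect to \<open>\<theta>\<close> in direction \<open>h\<close>,
  obtained by formally differentiating the recursion.\<close>

primrec dtraj :: "'p \<Rightarrow> 'z \<Rightarrow> 'p \<Rightarrow> nat \<Rightarrow> 'z" where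
  "dtraj \<theta> z h 0 = 0"
| "dtraj \<theta> z h (Suc t) = step \<theta> (dtraj \<theta> z h t) + H h (traj \<theta> z t)"

definition dobs :: "'p \<Rightarrow> 'z \<Rightarrow> 'p \<Rightarrow> nat \<Rightarrow> 'w" where
  "dobs \<theta> z h t = out \<theta> (dtraj \<theta> z h t) + N h (traj \<theta> z t)"

definition dcost :: "'p \<Rightarrow> 'z \<Rightarrow> 'p \<Rightarrow> real" where
  "dcost \<theta> z h = (\<Sum>t. 2 * b (obs \<theta> z t) (dobs \<theta> z h t))"

definition stable :: "real \<Rightarrow> real \<Rightarrow> 'p \<Rightarrow> bool" where
  "stable c a \<theta> \<longleftrightarrow> (\<forall>z t. norm (traj \<theta> z t) \<le> c * a ^ t * norm z)"

text \<open>The bounds on a parameter that make all estimates below uniform.\<close>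

definition tame :: "real \<Rightarrow> real \<Rightarrow> real \<Rightarrow> 'p \<Rightarrow> bool" where
  "tame c a \<eta> \<theta> \<longleftrightarrow> stable c a \<theta> \<and> (\<forall>z. norm (out \<theta> z) \<le> \<eta> * norm z)"

lemma linear_step: "linear (step \<theta>)"
  unfolding step_def
  using linear_compose_add[OF G0 bounded_linear.linear[OF bounded_bilinear.bounded_linear_right[OF H]]]
  by simp

lemma linear_out: "linear (out \<theta>)"
  unfolding out_def
  using linear_compose_add[OF P0 bounded_linear.linear[OF bounded_bilinear.bounded_linear_right[OF N]]]
  by simp

lemma traj_0 [simp]: "traj \<theta> z 0 = z"
  by (simp add: traj_def)

lemma traj_Suc [simp]: "traj \<theta> z (Suc t) = step \<theta> (traj \<theta> z t)"
  by (simp add: traj_def)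

lemma traj_step: "traj \<theta> (step \<theta> z) t = traj \<theta> z (Suc t)"
  by (simp add: traj_def funpow_swap1)

lemma linear_traj: "linear (\<lambda>z. traj \<theta> z t)"
proof (induction t)
  case 0 then show ?case using linear_id by (simp add: id_def)
next
  case (Suc t) then show ?case using linear_compose[OF Suc linear_step] by (simp add: o_def)
qed

lemma linear_obs: "linear (\<lambda>z. obs \<theta> z t)"
  using linear_compose[OF linear_traj linear_out] by (simp add: obs_def o_def)

lemma step_diff: "step \<theta>' z = step \<theta> z + H (\<theta>' - \<theta>) z"
  by (simp add: step_def bounded_bilinear.diff_left[OF H])

lemma out_diff: "out \<theta>' z = out \<theta> z + N (\<theta>' - \<theta>) z"
  by (simp add: out_def bounded_bilinear.diff_left[OF N])

lemma linear_dtraj: "linear (\<lambda>h. dtraj \<theta> z h t)"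
proof (induction t)
  case 0 then show ?case by (simp add: linear_zero)
next
  case (Suc t)
  show ?case
    using linear_compose_add[OF linear_compose[OF Suc linear_step]
        bounded_linear.linear[OF bounded_bilinear.bounded_linear_left[OF H]]]
    by (simp add: o_def)
qed

lemma linear_dobs: "linear (\<lambda>h. dobs \<theta> z h t)"
  unfolding dobs_def
  using linear_compose_add[OF linear_compose[OF linear_dtraj linear_out]
      bounded_linear.linear[OF bounded_bilinear.bounded_linear_left[OF N]]]
  by (simp add: o_def)

text \<open>Perturbing the step map by an operator of norm at most \<open>\<epsilon>\<close> raises the decay rate from \<open>a\<close>
  to only \<open>a + c * \<epsilon>\<close>, with the same constant \<open>c\<close>. A direct induction on
  \<open>norm (traj \<theta>' z t)\<close> would pick up a factor \<open>c\<close> in each step; the induction is therefore on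
  what remains of \<open>traj \<theta>' z t\<close> after \<open>k\<close> further steps of the unperturbed system.\<close>

lemma exponential_stability_perturbation:
  assumes st: "stable c a \<theta>" and a: "0 \<le> a" and c: "0 \<le> c" and \<epsilon>: "0 \<le> \<epsilon>"
    and H\<epsilon>: "\<And>z. norm (H (\<theta>' - \<theta>) z) \<le> \<epsilon> * norm z"
  shows "stable c (a + c * \<epsilon>) \<theta>'"
proof -
  have "norm (traj \<theta> (traj \<theta>' z t) k) \<le> c * a ^ k * (a + c * \<epsilon>) ^ t * norm z" for z t k
  proof (induction t arbitrary: k)
    case 0 then show ?case using st by (simp add: stable_def)
  next
    case (Suc t)
    let ?y = "traj \<theta>' z t"
    have "traj \<theta> (traj \<theta>' z (Suc t)) k = traj \<theta> ?y (Suc k) + traj \<theta> (H (\<theta>' - \<theta>) ?y) k"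
      by (simp only: traj_Suc[of \<theta>'] step_diff[of \<theta>' _ \<theta>] linear_add[OF linear_traj] traj_step)
    moreover have "norm (traj \<theta> ?y (Suc k)) \<le> c * a ^ Suc k * (a + c * \<epsilon>) ^ t * norm z"
      by (rule Suc)
    moreover have "norm (traj \<theta> (H (\<theta>' - \<theta>) ?y) k) \<le> c * a ^ k * (\<epsilon> * (c * (a + c * \<epsilon>) ^ t * norm z))"
    proof -
      have "norm (traj \<theta> (H (\<theta>' - \<theta>) ?y) k) \<le> c * a ^ k * norm (H (\<theta>' - \<theta>) ?y)"
        using st by (simp add: stable_def)
      also have "\<dots> \<le> c * a ^ k * (\<epsilon> * norm ?y)"
        by (intro mult_left_mono H\<epsilon>) (use a c in auto)
      also have "\<dots> \<le> c * a ^ k * (\<epsilon> * (c * (a + c * \<epsilon>) ^ t * norm z))"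
        using Suc[of 0] by (intro mult_left_mono) (use a c \<epsilon> in auto)
      finally show ?thesis .
    qed
    ultimately have "norm (traj \<theta> (traj \<theta>' z (Suc t)) k)
        \<le> c * a ^ Suc k * (a + c * \<epsilon>) ^ t * norm z + c * a ^ k * (\<epsilon> * (c * (a + c * \<epsilon>) ^ t * norm z))"
      by (metis (no_types, lifting) add_mono norm_triangle_le)
    then show ?case by (simp add: algebra_simps)
  qed
  from this[of _ _ 0] show ?thesis by (simp add: stable_def)
qed

text \<open>Forcing at a rate \<open>\<beta>\<close> above the decay rate \<open>a\<close> of the system produces a response at
  the same rate \<open>\<beta>\<close>. This is the variation-of-constants sum, bounded by the same induction over
  \<open>k\<close> further unforced steps as above.\<close>

lemma forced_response_bound:
  assumes st: "stable c a \<theta>" and a: "0 \<le> a" "a < \<beta>" and c: "0 \<le> c"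
    and d0: "d 0 = 0" and dS: "\<And>t. d (Suc t) = step \<theta> (d t) + g t"
    and g: "\<And>t. norm (g t) \<le> e * \<beta> ^ t"
  shows "norm (d t) \<le> c * e / (\<beta> - a) * \<beta> ^ t"
proof -
  have e: "0 \<le> e" using g[of 0] by (simp add: norm_ge_zero[THEN order_trans])
  have "norm (traj \<theta> (d t) k) \<le> a ^ k * (c * e / (\<beta> - a) * \<beta> ^ t)" for k
  proof (induction t arbitrary: k)
    case 0 then show ?case using linear_0[OF linear_traj] d0 a c e by simp
  next
    case (Suc t)
    have "traj \<theta> (d (Suc t)) k = traj \<theta> (d t) (Suc k) + traj \<theta> (g t) k"
      by (simp only: dS linear_add[OF linear_traj] traj_step)
    moreover have "norm (traj \<theta> (g t) k) \<le> c * a ^ k * (e * \<beta> ^ t)"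
      using st g[of t] a c unfolding stable_def
      by (meson mult_left_mono order_trans mult_nonneg_nonneg zero_le_power)
    ultimately have "norm (traj \<theta> (d (Suc t)) k)
        \<le> a ^ Suc k * (c * e / (\<beta> - a) * \<beta> ^ t) + c * a ^ k * (e * \<beta> ^ t)"
      using Suc[of "Suc k"] by (metis (no_types, lifting) add_mono norm_triangle_le)
    also have "\<dots> = a ^ k * (c * e / (\<beta> - a) * \<beta> ^ Suc t)"
      using a by (simp add: field_simps)
    finally show ?case .
  qed
  from this[of 0] show ?thesis by simp
qed

text \<open>The Lyapunov argument: the sum \<open>V z\<close> of the squared trajectory loses \<open>(norm z)\<^sup>2\<close> in each
  step, which is at least \<open>V z / c\<close>.\<close>

lemma exponential_stability_of_square_summable:
  assumes c: "1 \<le> c" and part: "\<And>z n. (\<Sum>t<n. (norm (traj \<theta> z t))\<^sup>2) \<le> c * (norm z)\<^sup>2"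
  shows "stable (sqrt c) (sqrt (1 - 1 / c)) \<theta>"
proof -
  define V where "V z = (\<Sum>t. (norm (traj \<theta> z t))\<^sup>2)" for z
  have sm: "summable (\<lambda>t. (norm (traj \<theta> z t))\<^sup>2)" for z
    by (rule summableI_nonneg_bounded[OF _ part]) simp
  have V_le: "V z \<le> c * (norm z)\<^sup>2" for z
    unfolding V_def by (rule suminf_le_const[OF sm part])
  have V_split: "V z = (norm z)\<^sup>2 + V (step \<theta> z)" for z
    unfolding V_def traj_step using suminf_split_head[OF sm[of z]] by simp
  have V_nonneg: "0 \<le> V z" for z unfolding V_def by (rule suminf_nonneg[OF sm]) simp
  have V_ge: "(norm z)\<^sup>2 \<le> V z" for z using V_split[of z] V_nonneg by simp
  have contract: "V (step \<theta> z) \<le> (1 - 1 / c) * V z" for z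
  proof -
    have "V z / c \<le> (norm z)\<^sup>2" using V_le[of z] c by (simp add: field_simps)
    then show ?thesis using V_split[of z] by (simp add: left_diff_distrib)
  qed
  have q: "0 \<le> 1 - 1 / c" using c by simp
  have pw: "(sqrt (1 - 1 / c) ^ t)\<^sup>2 = (1 - 1 / c) ^ t" for t
    using q by (metis mult.commute power_mult real_sqrt_pow2)
  have "V (traj \<theta> z t) \<le> (1 - 1 / c) ^ t * V z" for z t
  proof (induction t)
    case (Suc t)
    have "V (traj \<theta> z (Suc t)) \<le> (1 - 1 / c) * V (traj \<theta> z t)" using contract by simp
    also have "\<dots> \<le> (1 - 1 / c) * ((1 - 1 / c) ^ t * V z)" by (rule mult_left_mono[OF Suc q])
    finally show ?case by simp
  qed simp
  then have "(norm (traj \<theta> z t))\<^sup>2 \<le> (1 - 1 / c) ^ t * (c * (norm z)\<^sup>2)" for z t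
    using V_ge[of "traj \<theta> z t"] mult_left_mono[OF V_le[of z], of "(1 - 1 / c) ^ t"] q
    by (smt (verit) zero_le_power)
  then have "(norm (traj \<theta> z t))\<^sup>2 \<le> (sqrt c * sqrt (1 - 1 / c) ^ t * norm z)\<^sup>2" for z t
    using c pw by (simp add: power_mult_distrib mult_ac)
  then show ?thesis
    unfolding stable_def
    by (meson c q mult_nonneg_nonneg norm_ge_zero order_trans power2_le_imp_le real_sqrt_ge_zero zero_le_one zero_le_power)
qed

text \<open>The derivative and the two remainders of the trajectory solve the same recursion, driven by
  \<open>H h\<close> applied to the quantity of one order less. Starting from
  \<open>norm (traj \<theta>' z t) \<le> c * a ^ t * norm z\<close>, each application of
  \<open>forced_response_bound\<close> gains one factor \<open>norm h\<close>: first the increment of the trajectory is of order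
  \<open>norm h\<close>, then the increment minus its linear part is of order \<open>(norm h)\<^sup>2\<close>. The quadratic form
  of the outputs inherits these orders, and the sum over time converges geometrically.\<close>

lemma uniform_first_order_expansion:
  assumes a: "0 \<le> a" "a < 1" and c: "0 < c" and \<eta>: "0 \<le> \<eta>"
  obtains K where "0 < K"
    "\<And>\<theta> \<theta>' z. tame c a \<eta> \<theta> \<Longrightarrow> tame c a \<eta> \<theta>' \<Longrightarrow>
      summable (\<lambda>t. b (obs \<theta> z t) (obs \<theta> z t)) \<and>
      \<bar>cost \<theta> z\<bar> \<le> K * (norm z)\<^sup>2 \<and>
      linear (dcost \<theta> z) \<and>
      \<bar>cost \<theta>' z - cost \<theta> z\<bar> \<le> K * norm (\<theta>' - \<theta>) * (norm z)\<^sup>2 \<and>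
      \<bar>cost \<theta>' z - cost \<theta> z - dcost \<theta> z (\<theta>' - \<theta>)\<bar> \<le> K * (norm (\<theta>' - \<theta>))\<^sup>2 * (norm z)\<^sup>2"
proof -
  obtain kH where kH: "0 < kH" "\<And>h z. norm (H h z) \<le> norm h * norm z * kH"
    using bounded_bilinear.pos_bounded[OF H] by blast
  obtain kN where kN: "0 < kN" "\<And>h z. norm (N h z) \<le> norm h * norm z * kN"
    using bounded_bilinear.pos_bounded[OF N] by blast
  obtain kb where kb: "0 < kb" "\<And>u v. norm (b u v) \<le> norm u * norm v * kb"
    using bounded_bilinear.pos_bounded[OF b] by blast
  \<comment> \<open>one rate strictly between \<open>a\<close> and \<open>1\<close> serves for all orders, since only the forcing has to
    decay at this rate\<close>
  define \<beta> where "\<beta> = (1 + a) / 2"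
  have \<beta>: "a < \<beta>" "0 < \<beta>" "\<beta> < 1" "\<beta>\<^sup>2 < 1" using a by (auto simp: \<beta>_def power_less_one_iff)
  \<comment> \<open>\<open>K1\<close>, \<open>K2\<close>: trajectory at first and second order; \<open>K5\<close>, \<open>K3\<close>, \<open>K4\<close>: output at order zero,
    one and two\<close>
  define K1 where "K1 = c * (kH * c) / (\<beta> - a)"
  define K2 where "K2 = c * (kH * K1) / (\<beta> - a)"
  define K3 where "K3 = \<eta> * K1 + kN * c"
  define K4 where "K4 = \<eta> * K2 + kN * K1"
  define K5 where "K5 = \<eta> * c"
  define T1 T2 T3 where "T1 = kb * (K5 * K5) / (1 - \<beta>\<^sup>2)" and "T2 = kb * (2 * K5 * K3) / (1 - \<beta>\<^sup>2)"
    and "T3 = kb * (K3 * K3 + 2 * K5 * K4) / (1 - \<beta>\<^sup>2)"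
  define K where "K = 1 + T1 + T2 + T3"
  have nn: "0 \<le> K1" "0 \<le> K2" "0 \<le> K3" "0 \<le> K4" "0 \<le> K5"
    using kH(1) kN(1) c \<eta> \<beta> by (simp_all add: K1_def K2_def K3_def K4_def K5_def)
  have Tnn: "0 \<le> T1" "0 \<le> T2" "0 \<le> T3"
    using nn kb(1) \<beta> by (simp_all add: T1_def T2_def T3_def)
  have Kge: "kb * (K5 * K5) / (1 - \<beta>\<^sup>2) \<le> K" "kb * (2 * K5 * K3) / (1 - \<beta>\<^sup>2) \<le> K"
    "kb * (K3 * K3 + 2 * K5 * K4) / (1 - \<beta>\<^sup>2) \<le> K" "0 < K"
    using Tnn by (simp_all add: K_def T1_def[symmetric] T2_def[symmetric] T3_def[symmetric])
  have sums: "summable f" "\<bar>suminf f\<bar> \<le> K * Y"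
    if "\<And>t. \<bar>f t\<bar> \<le> kb * X * Y * (\<beta>\<^sup>2) ^ t" "kb * X / (1 - \<beta>\<^sup>2) \<le> K" "0 \<le> Y" for f :: "nat \<Rightarrow> real" and X Y
  proof -
    show "summable f" using abs_suminf_geometric_le(1)[OF _ \<beta>(4) that(1)] by simp
    have "\<bar>suminf f\<bar> \<le> kb * X * Y / (1 - \<beta>\<^sup>2)"
      using abs_suminf_geometric_le(2)[OF _ \<beta>(4) that(1)] by simp
    also have "\<dots> \<le> K * Y" using mult_right_mono[OF that(2,3)] by simp
    finally show "\<bar>suminf f\<bar> \<le> K * Y" .
  qed
  have b_bound: "\<bar>b u v\<bar> \<le> kb * (X1 * X2) * (Y1 * Y2) * (\<beta>\<^sup>2) ^ t"
    if "norm u \<le> X1 * Y1 * \<beta> ^ t" "norm v \<le> X2 * Y2 * \<beta> ^ t" for u v X1 X2 Y1 Y2 t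
  proof -
    have "\<bar>b u v\<bar> \<le> norm u * norm v * kb" using kb(2)[of u v] by simp
    also have "\<dots> \<le> (X1 * Y1 * \<beta> ^ t) * (X2 * Y2 * \<beta> ^ t) * kb"
      using that kb(1) by (intro mult_mono mult_right_mono) (auto intro: order_trans[OF norm_ge_zero])
    finally show ?thesis by (simp add: power2_eq_square power_mult_distrib mult_ac)
  qed
  show thesis
  proof (rule that[OF Kge(4)])
    fix \<theta> \<theta>' :: 'p and z :: 'z
    assume "tame c a \<eta> \<theta>" "tame c a \<eta> \<theta>'"
    then have st: "stable c a \<theta>" "stable c a \<theta>'"
      and ob: "\<And>z. norm (out \<theta> z) \<le> \<eta> * norm z" "\<And>z. norm (out \<theta>' z) \<le> \<eta> * norm z"
      by (simp_all add: tame_def)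
    define n where "n = norm z"
    have n: "0 \<le> n" by (simp add: n_def)
    have stb: "norm (traj \<phi> z t) \<le> c * n * \<beta> ^ t" if "stable c a \<phi>" for \<phi> t
    proof -
      have "norm (traj \<phi> z t) \<le> c * a ^ t * n" using that by (simp add: stable_def n_def)
      also have "\<dots> \<le> c * \<beta> ^ t * n"
        using a c n \<beta> by (intro mult_right_mono mult_left_mono power_mono) auto
      finally show ?thesis by (simp add: mult_ac)
    qed
    have w: "norm (obs \<phi> z t) \<le> K5 * n * \<beta> ^ t"
      if "stable c a \<phi>" "\<And>z. norm (out \<phi> z) \<le> \<eta> * norm z" for \<phi> t
      unfolding obs_def K5_def
      using order_trans[OF that(2) mult_left_mono[OF stb[OF that(1)] \<eta>]] by (simp add: mult_ac)
    have forced: "norm (d t) \<le> c * (kH * X) / (\<beta> - a) * (norm h * Y) * \<beta> ^ t"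
      if "d 0 = 0" "\<And>t. d (Suc t) = step \<theta> (d t) + H h (y t)" "\<And>t. norm (y t) \<le> X * Y * \<beta> ^ t"
      for d y h X Y t
    proof -
      have "norm (H h (y t)) \<le> (kH * X * (norm h * Y)) * \<beta> ^ t" for t
      proof -
        have "norm (H h (y t)) \<le> norm h * norm (y t) * kH" by (rule kH)
        also have "\<dots> \<le> norm h * (X * Y * \<beta> ^ t) * kH"
          by (intro mult_right_mono mult_left_mono that) (use kH in auto)
        finally show ?thesis by (simp add: mult_ac)
      qed
      from forced_response_bound[OF st(1) a(1) \<beta>(1) _ that(1,2) this] c show ?thesis by (simp add: mult_ac)
    qed
    have Nb: "norm (N h y) \<le> kN * X * (norm h * Y) * \<beta> ^ t"
      if "norm y \<le> X * Y * \<beta> ^ t" for h y X Y t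
    proof -
      have "norm (N h y) \<le> norm h * norm y * kN" by (rule kN)
      also have "\<dots> \<le> norm h * (X * Y * \<beta> ^ t) * kN"
        by (intro mult_right_mono mult_left_mono that) (use kN in auto)
      finally show ?thesis by (simp add: mult_ac)
    qed
    have outb: "norm (out \<theta> y) \<le> \<eta> * X * Y * \<beta> ^ t" if "norm y \<le> X * Y * \<beta> ^ t" for y X Y t
      using order_trans[OF ob(1) mult_left_mono[OF that \<eta>]] by (simp add: mult_ac)
    have dz: "norm (dtraj \<theta> z h t) \<le> K1 * (norm h * n) * \<beta> ^ t" for h t
      unfolding K1_def by (rule forced[OF _ _ stb[OF st(1)]]) simp_all
    have \<omega>: "norm (dobs \<theta> z h t) \<le> K3 * (norm h * n) * \<beta> ^ t" for h t
      using norm_triangle_le[OF add_mono[OF outb[OF dz[of h t]] Nb[OF stb[OF st(1), of t], of h]]]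
      unfolding dobs_def K3_def by (simp add: algebra_simps)
    let ?h = "\<theta>' - \<theta>"
    define d where "d t = traj \<theta>' z t - traj \<theta> z t" for t
    have d: "norm (d t) \<le> K1 * (norm ?h * n) * \<beta> ^ t" for t
      unfolding K1_def
      by (rule forced[OF _ _ stb[OF st(2)]])
         (simp_all add: d_def linear_diff[OF linear_step] step_diff[of \<theta>' _ \<theta>])
    define r where "r t = d t - dtraj \<theta> z ?h t" for t
    have dS: "d (Suc t) = step \<theta> (d t) + H ?h (traj \<theta>' z t)" for t
      by (simp add: d_def linear_diff[OF linear_step] step_diff[of \<theta>' _ \<theta>])
    have r: "norm (r t) \<le> K2 * (norm ?h * (norm ?h * n)) * \<beta> ^ t" for t
      unfolding K2_def
    proof (rule forced[OF _ _ d])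
      show "r (Suc t) = step \<theta> (r t) + H ?h (d t)" for t
        by (simp add: r_def dS linear_diff[OF linear_step] bounded_bilinear.diff_right[OF H])
           (simp add: d_def bounded_bilinear.diff_right[OF H])
    qed (simp add: r_def d_def)
    have wd_eq: "obs \<theta>' z t - obs \<theta> z t = out \<theta> (d t) + N ?h (traj \<theta>' z t)" for t
      by (simp add: obs_def d_def linear_diff[OF linear_out] out_diff[of \<theta>' _ \<theta>])
    have wd: "norm (obs \<theta>' z t - obs \<theta> z t) \<le> K3 * (norm ?h * n) * \<beta> ^ t" for t
      using norm_triangle_le[OF add_mono[OF outb[OF d[of t]] Nb[OF stb[OF st(2), of t], of ?h]]]
      unfolding wd_eq K3_def by (simp add: algebra_simps)
    have wr_eq: "obs \<theta>' z t - obs \<theta> z t - dobs \<theta> z ?h t = out \<theta> (r t) + N ?h (d t)" for t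
      unfolding wd_eq dobs_def r_def
      by (simp add: linear_diff[OF linear_out]) (simp add: d_def bounded_bilinear.diff_right[OF N])
    have wr: "norm (obs \<theta>' z t - obs \<theta> z t - dobs \<theta> z ?h t)
        \<le> K4 * ((norm ?h)\<^sup>2 * n) * \<beta> ^ t" for t
      using norm_triangle_le[OF add_mono[OF outb[OF r[of t]] Nb[OF d[of t], of ?h]]]
      unfolding wr_eq K4_def by (simp add: algebra_simps power2_eq_square)
    note bl = bounded_bilinear.add_left[OF b] bounded_bilinear.add_right[OF b]
      bounded_bilinear.diff_left[OF b] bounded_bilinear.diff_right[OF b]
    have c0: "summable (\<lambda>t. b (obs \<phi> z t) (obs \<phi> z t))" "\<bar>cost \<phi> z\<bar> \<le> K * n\<^sup>2"
      if "stable c a \<phi>" "\<And>z. norm (out \<phi> z) \<le> \<eta> * norm z" for \<phi>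
    proof -
      have "\<bar>b (obs \<phi> z t) (obs \<phi> z t)\<bar> \<le> kb * (K5 * K5) * n\<^sup>2 * (\<beta>\<^sup>2) ^ t" for t
        using b_bound[OF w[OF that] w[OF that]] by (simp only: power2_eq_square[of n])
      from sums[OF this Kge(1)]
      show "summable (\<lambda>t. b (obs \<phi> z t) (obs \<phi> z t))" "\<bar>cost \<phi> z\<bar> \<le> K * n\<^sup>2"
        by (simp_all add: cost_def)
    qed
    note c1 = c0[OF st(1) ob(1)] and c2 = c0[OF st(2) ob(2)]
    have cd: "cost \<theta>' z - cost \<theta> z = (\<Sum>t. b (obs \<theta>' z t) (obs \<theta>' z t) - b (obs \<theta> z t) (obs \<theta> z t))"
      unfolding cost_def by (rule suminf_diff[OF c2(1) c1(1)])
    have lip: "\<bar>cost \<theta>' z - cost \<theta> z\<bar> \<le> K * (norm ?h * n\<^sup>2)"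
      unfolding cd
    proof (rule sums[OF _ Kge(2)])
      fix t
      have "b (obs \<theta>' z t) (obs \<theta>' z t) - b (obs \<theta> z t) (obs \<theta> z t)
        = b (obs \<theta>' z t - obs \<theta> z t) (obs \<theta>' z t) + b (obs \<theta>' z t - obs \<theta> z t) (obs \<theta> z t)"
        by (simp add: bl b_sym[of "obs \<theta>' z t" "obs \<theta> z t"])
      then show "\<bar>b (obs \<theta>' z t) (obs \<theta>' z t) - b (obs \<theta> z t) (obs \<theta> z t)\<bar>
          \<le> kb * (2 * K5 * K3) * (norm ?h * n\<^sup>2) * (\<beta>\<^sup>2) ^ t"
        using b_bound[OF wd w[OF st(2) ob(2)], of t] b_bound[OF wd w[OF st(1) ob(1)], of t]
        by (simp add: power2_eq_square algebra_simps)
    qed (simp add: n)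
    have ds: "summable (\<lambda>t. 2 * b (obs \<theta> z t) (dobs \<theta> z h t))" for h
    proof (rule sums(1)[OF _ Kge(2)])
      show "\<bar>2 * b (obs \<theta> z t) (dobs \<theta> z h t)\<bar> \<le> kb * (2 * K5 * K3) * (norm h * n\<^sup>2) * (\<beta>\<^sup>2) ^ t" for t
        using b_bound[OF w[OF st(1) ob(1)] \<omega>, of t h] by (simp add: power2_eq_square algebra_simps abs_mult)
    qed (simp add: n)
    have lin: "linear (dcost \<theta> z)"
    proof (rule linearI)
      fix x y
      show "dcost \<theta> z (x + y) = dcost \<theta> z x + dcost \<theta> z y"
        unfolding dcost_def linear_add[OF linear_dobs] bl
        using suminf_add[OF ds[of x] ds[of y]] by (simp add: algebra_simps)
      show "dcost \<theta> z (s *\<^sub>R x) = s *\<^sub>R dcost \<theta> z x" for s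
        unfolding dcost_def linear_scale[OF linear_dobs] bounded_bilinear.scaleR_right[OF b]
        using suminf_mult[OF ds[of x], of s] by (simp add: algebra_simps)
    qed
    have rem_eq: "cost \<theta>' z - cost \<theta> z - dcost \<theta> z ?h = (\<Sum>t. (b (obs \<theta>' z t) (obs \<theta>' z t) -
       b (obs \<theta> z t) (obs \<theta> z t)) - 2 * b (obs \<theta> z t) (dobs \<theta> z ?h t))"
      unfolding cd dcost_def by (rule suminf_diff[OF summable_diff[OF c2(1) c1(1)] ds])
    have rem: "\<bar>cost \<theta>' z - cost \<theta> z - dcost \<theta> z ?h\<bar> \<le> K * ((norm ?h)\<^sup>2 * n\<^sup>2)"
      unfolding rem_eq
    proof (rule sums[OF _ Kge(3)])
      fix t
      have "(b (obs \<theta>' z t) (obs \<theta>' z t) - b (obs \<theta> z t) (obs \<theta> z t)) - 2 * b (obs \<theta> z t) (dobs \<theta> z ?h t)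
        = b (obs \<theta>' z t - obs \<theta> z t) (obs \<theta>' z t - obs \<theta> z t)
          + 2 * b (obs \<theta> z t) (obs \<theta>' z t - obs \<theta> z t - dobs \<theta> z ?h t)"
        by (simp add: bl b_sym[of "obs \<theta>' z t" "obs \<theta> z t"])
      then show "\<bar>(b (obs \<theta>' z t) (obs \<theta>' z t) - b (obs \<theta> z t) (obs \<theta> z t)) - 2 * b (obs \<theta> z t) (dobs \<theta> z ?h t)\<bar>
          \<le> kb * (K3 * K3 + 2 * K5 * K4) * ((norm ?h)\<^sup>2 * n\<^sup>2) * (\<beta>\<^sup>2) ^ t"
        using b_bound[OF wd wd, of t] b_bound[OF w[OF st(1) ob(1)] wr, of t]
        by (simp add: power2_eq_square algebra_simps)
    qed (simp add: n)
    show "summable (\<lambda>t. b (obs \<theta> z t) (obs \<theta> z t)) \<and>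
      \<bar>cost \<theta> z\<bar> \<le> K * (norm z)\<^sup>2 \<and> linear (dcost \<theta> z) \<and>
      \<bar>cost \<theta>' z - cost \<theta> z\<bar> \<le> K * norm ?h * (norm z)\<^sup>2 \<and>
      \<bar>cost \<theta>' z - cost \<theta> z - dcost \<theta> z ?h\<bar> \<le> K * (norm ?h)\<^sup>2 * (norm z)\<^sup>2"
      using c1 lin lip rem by (simp add: n_def mult_ac)
  qed
qed

text \<open>The admissible radius depends only on the bounds, not on the parameter at the centre; it is
  chosen such that the decay rate moves half of the way from \<open>a\<close> to \<open>1\<close>.\<close>

lemma uniformly_stable_neighbourhood:
  assumes a: "0 \<le> a" "a < 1" and c: "0 < c" and \<eta>: "0 \<le> \<eta>"
  obtains r a' \<eta>' where "0 < r" "0 \<le> a'" "a' < 1" "0 \<le> \<eta>'"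
    "\<And>\<theta> \<theta>'. tame c a \<eta> \<theta> \<Longrightarrow> norm (\<theta>' - \<theta>) \<le> r \<Longrightarrow> tame c a' \<eta>' \<theta>'"
proof -
  obtain kH where kH: "0 < kH" "\<And>h z. norm (H h z) \<le> norm h * norm z * kH"
    using bounded_bilinear.pos_bounded[OF H] by blast
  obtain kN where kN: "0 < kN" "\<And>h z. norm (N h z) \<le> norm h * norm z * kN"
    using bounded_bilinear.pos_bounded[OF N] by blast
  define r where "r = (1 - a) / (2 * c * kH)"
  have r: "0 < r" using a c kH by (simp add: r_def)
  show thesis
  proof (rule that[OF r, of "(1 + a) / 2" "\<eta> + kN * r"])
    fix \<theta> \<theta>' :: 'p
    assume "tame c a \<eta> \<theta>" and d: "norm (\<theta>' - \<theta>) \<le> r"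
    then have st: "stable c a \<theta>" and ob: "\<And>z. norm (out \<theta> z) \<le> \<eta> * norm z"
      by (simp_all add: tame_def)
    have "norm (H (\<theta>' - \<theta>) y) \<le> kH * r * norm y" for y
      by (rule order_trans[OF kH(2)])
         (use mult_right_mono[OF d, of "norm y * kH"] kH(1) in \<open>simp add: mult_ac\<close>)
    from exponential_stability_perturbation[OF st a(1) _ _ this] c kH r
    have "stable c (a + c * (kH * r)) \<theta>'" by simp
    moreover have "a + c * (kH * r) = (1 + a) / 2" using c kH by (simp add: r_def field_simps)
    moreover have "norm (out \<theta>' z) \<le> (\<eta> + kN * r) * norm z" for z
    proof -
      have "norm (N (\<theta>' - \<theta>) z) \<le> kN * r * norm z"
        by (rule order_trans[OF kN(2)])
           (use mult_right_mono[OF d, of "norm z * kN"] kN(1) in \<open>simp add: mult_ac\<close>)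
      then show ?thesis
        unfolding out_diff[of \<theta>' z \<theta>] using ob[of z] norm_triangle_ineq[of "out \<theta> z" "N (\<theta>' - \<theta>) z"]
        by (simp add: algebra_simps)
    qed
    ultimately show "tame c ((1 + a) / 2) (\<eta> + kN * r) \<theta>'"
      by (simp add: tame_def)
  qed (use a \<eta> kN r in auto)
qed

end

section \<open>Moments of the initial state\<close>

lemma pos_def_lower_bound:
  fixes M :: "real^'m^'m"
  assumes "pos_def M"
  obtains s where "0 < s" "\<And>x. s * (norm x)\<^sup>2 \<le> x \<bullet> (M *v x)"
proof -
  have ne: "sphere (0::real^'m) 1 \<noteq> {}" by (auto intro: exI[of _ "axis undefined 1"])
  have "continuous_on (sphere 0 1) (\<lambda>x::real^'m. x \<bullet> (M *v x))"
    by (intro continuous_on_inner continuous_on_id linear_continuous_on matrix_vector_mul_bounded_linear)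
  from continuous_attains_inf[OF compact_sphere ne this]
  obtain u where u: "u \<in> sphere 0 1" "\<And>x. x \<in> sphere 0 1 \<Longrightarrow> u \<bullet> (M *v u) \<le> x \<bullet> (M *v x)"
    by blast
  show thesis
  proof (rule that)
    show "0 < u \<bullet> (M *v u)" proof -
      have "u \<noteq> 0" using u(1) by auto
      then show ?thesis using assms by (simp add: pos_def_def)
    qed
    show "u \<bullet> (M *v u) * (norm x)\<^sup>2 \<le> x \<bullet> (M *v x)" for x
    proof (cases "x = 0")
      case False
      have "u \<bullet> (M *v u) \<le> sgn x \<bullet> (M *v sgn x)" using u(2)[of "sgn x"] False by (simp add: norm_sgn)
      also have "\<dots> = x \<bullet> (M *v x) / (norm x)\<^sup>2"
        by (simp add: sgn_div_norm matrix_vector_mult_scaleR power2_eq_square field_simps)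
      finally show ?thesis using False by (simp add: field_simps)
    qed simp
  qed
qed

lemma symmetric_form_commute:
  fixes M :: "real^'m^'m"
  assumes "transpose M = M"
  shows "x \<bullet> (M *v y) = y \<bullet> (M *v x)"
  by (metis assms dot_lmul_matrix inner_commute transpose_matrix_vector)

text \<open>The trace and the form \<open>M \<mapsto> l \<bullet> (M *v l)\<close> are bounded linear functionals of a matrix, so their
  means can be read off from the Bochner integral that defines \<open>\<Sigma>\<close>.\<close>

lemma initial_distribution_moments:
  assumes D: "initial_distribution \<Sigma> D"
  shows "integrable D (\<lambda>x. (norm x)\<^sup>2)" "(\<integral>x. (norm x)\<^sup>2 \<partial>D) = trace \<Sigma>"
    "integrable D (\<lambda>x. (l \<bullet> x + p)\<^sup>2)" "(\<integral>x. (l \<bullet> x + p)\<^sup>2 \<partial>D) = l \<bullet> (\<Sigma> *v l) + p\<^sup>2"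
proof -
  interpret prob_space D using D by (simp add: initial_distribution_def)
  have mean: "has_bochner_integral D (\<lambda>x. x) 0"
    and cov: "has_bochner_integral D (\<lambda>x. \<chi> i j. x $ i * x $ j) \<Sigma>"
    using D by (simp_all add: initial_distribution_def)
  have "bounded_linear (trace :: real^'a^'a \<Rightarrow> real)"
    by (intro linear_conv_bounded_linear[THEN iffD1] linearI)
       (simp_all add: trace_def sum.distrib sum_distrib_left)
  from has_bochner_integral_bounded_linear[OF this cov]
  have "has_bochner_integral D (\<lambda>x. (norm x)\<^sup>2) (trace \<Sigma>)"
    by (simp add: trace_def power2_norm_eq_inner inner_vec_def)
  then show "integrable D (\<lambda>x. (norm x)\<^sup>2)" "(\<integral>x. (norm x)\<^sup>2 \<partial>D) = trace \<Sigma>"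
    by (simp_all add: has_bochner_integral_iff)
  have "bounded_linear (\<lambda>M::real^'a^'a. l \<bullet> (M *v l))"
    by (intro linear_conv_bounded_linear[THEN iffD1] linearI)
       (simp_all add: matrix_vector_mult_add_rdistrib inner_add_right flip: scaleR_matrix_vector_assoc)
  from has_bochner_integral_bounded_linear[OF this cov]
  have sq: "has_bochner_integral D (\<lambda>x. (l \<bullet> x)\<^sup>2) (l \<bullet> (\<Sigma> *v l))"
    by (simp add: inner_vec_def matrix_vector_mult_def power2_eq_square sum_distrib_left sum_distrib_right mult_ac)
  have lin: "has_bochner_integral D (\<lambda>x. l \<bullet> x) 0"
    using has_bochner_integral_bounded_linear[OF bounded_linear_inner_right mean, of l] by simp
  have "has_bochner_integral D (\<lambda>x. (l \<bullet> x)\<^sup>2 + (2 * p) * (l \<bullet> x) + p\<^sup>2) (l \<bullet> (\<Sigma> *v l) + (2 * p) * 0 + p\<^sup>2)"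
    by (intro has_bochner_integral_add sq has_bochner_integral_mult_right lin)
       (simp add: has_bochner_integral_iff prob_space)
  then have "has_bochner_integral D (\<lambda>x. (l \<bullet> x + p)\<^sup>2) (l \<bullet> (\<Sigma> *v l) + p\<^sup>2)"
    by (simp add: power2_sum algebra_simps)
  then show "integrable D (\<lambda>x. (l \<bullet> x + p)\<^sup>2)" "(\<integral>x. (l \<bullet> x + p)\<^sup>2 \<partial>D) = l \<bullet> (\<Sigma> *v l) + p\<^sup>2"
    by (simp_all add: has_bochner_integral_iff)
qed

text \<open>Since \<open>x\<close> has mean zero, the second moment matrix of \<open>(x, 1)\<close> is block diagonal with
  blocks \<open>\<Sigma>\<close> and \<open>1\<close>, hence at least \<open>\<mu>\<close> times the identity. So the mean square of a linear image of
  \<open>(x, 1)\<close> controls its operator norm; this turns a bound on an average into a bound for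
  every initial state.\<close>

lemma linear_image_second_moment:
  fixes \<Lambda> :: "(real^'n) \<times> real \<Rightarrow> 'w::euclidean_space"
  assumes D: "initial_distribution \<Sigma> D" and \<Lambda>: "linear \<Lambda>"
    and \<mu>: "0 < \<mu>" "\<mu> \<le> 1" "\<And>l. \<mu> * (norm l)\<^sup>2 \<le> l \<bullet> (\<Sigma> *v l)"
  shows "integrable D (\<lambda>x. (norm (\<Lambda> (x, 1)))\<^sup>2)"
    and "\<mu> * (norm (\<Lambda> z))\<^sup>2 \<le> (norm z)\<^sup>2 * (\<integral>x. (norm (\<Lambda> (x, 1)))\<^sup>2 \<partial>D)"
proof -
  define a where "a e = adjoint \<Lambda> e" for e
  have a: "\<Lambda> z \<bullet> e = z \<bullet> a e" for z e
    unfolding a_def by (simp add: adjoint_works[OF \<Lambda>])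
  have norm_\<Lambda>: "(norm (\<Lambda> z))\<^sup>2 = (\<Sum>e\<in>Basis. (z \<bullet> a e)\<^sup>2)" for z
    by (rule trans[OF power2_norm_eq_inner trans[OF euclidean_inner]]) (simp add: a power2_eq_square)
  have a1: "(x, 1) \<bullet> a e = fst (a e) \<bullet> x + snd (a e)" for x e
    by (simp add: inner_prod_def inner_commute)
  note mom = initial_distribution_moments[OF D]
  show "integrable D (\<lambda>x. (norm (\<Lambda> (x, 1)))\<^sup>2)"
    unfolding norm_\<Lambda> a1 using mom(3) by auto
  have int: "(\<integral>x. (norm (\<Lambda> (x, 1)))\<^sup>2 \<partial>D) = (\<Sum>e\<in>Basis. fst (a e) \<bullet> (\<Sigma> *v fst (a e)) + (snd (a e))\<^sup>2)"
    unfolding norm_\<Lambda> a1 using mom(3,4) by (simp add: Bochner_Integration.integral_sum)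
  have "\<mu> * (z \<bullet> a e)\<^sup>2 \<le> (norm z)\<^sup>2 * (fst (a e) \<bullet> (\<Sigma> *v fst (a e)) + (snd (a e))\<^sup>2)" for e
  proof -
    have "\<mu> * (z \<bullet> a e)\<^sup>2 \<le> \<mu> * ((norm z)\<^sup>2 * (norm (a e))\<^sup>2)"
      using \<mu> Cauchy_Schwarz_ineq[of z "a e"] by (simp add: power2_norm_eq_inner)
    also have "\<dots> = (norm z)\<^sup>2 * (\<mu> * (norm (fst (a e)))\<^sup>2 + \<mu> * (snd (a e))\<^sup>2)"
      by (simp add: norm_prod_def algebra_simps)
    also have "\<dots> \<le> (norm z)\<^sup>2 * (fst (a e) \<bullet> (\<Sigma> *v fst (a e)) + (snd (a e))\<^sup>2)"
      using \<mu> mult_right_mono[OF \<mu>(2), of "(snd (a e))\<^sup>2"] by (intro mult_left_mono add_mono) auto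
    finally show ?thesis .
  qed
  then show "\<mu> * (norm (\<Lambda> z))\<^sup>2 \<le> (norm z)\<^sup>2 * (\<integral>x. (norm (\<Lambda> (x, 1)))\<^sup>2 \<partial>D)"
    unfolding norm_\<Lambda> int[unfolded norm_\<Lambda>] sum_distrib_left by (rule sum_mono)
qed

section \<open>The discounted tracking problem as a linear system\<close>

text \<open>The tracking problem is homogenised: the state \<open>x\<close> is extended by a coordinate \<open>s\<close> that starts at
  \<open>1\<close> and multiplies both the target and the constant part of the control. The closed loop is then
  linear, and it remains affine in the policy. Scaling each step by \<open>sqrt \<gamma>\<close> puts the factor
  \<open>\<gamma> ^ t\<close> into the quadratic form of the outputs and makes the extra coordinate decay.\<close>

locale discounted_lqr =
  fixes A Q :: "real^'n^'n" and B :: "real^'k^'n" and R :: "real^'k^'k"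
    and xstar :: "real^'n" and \<gamma> :: real
  assumes Q: "pos_def Q" and R: "pos_def R" and \<gamma>: "0 < \<gamma>" "\<gamma> < 1"
begin

definition feedback :: "('n, 'k) policy \<Rightarrow> (real^'n) \<times> real \<Rightarrow> real^'k" where
  "feedback \<theta> z = fst \<theta> *v fst z + snd z *\<^sub>R (snd \<theta> *v xstar)"

definition form :: "(real^'n) \<times> (real^'k) \<Rightarrow> (real^'n) \<times> (real^'k) \<Rightarrow> real" where
  "form u v = fst u \<bullet> (Q *v fst v) + snd u \<bullet> (R *v snd v)"

definition drift :: "(real^'n) \<times> real \<Rightarrow> (real^'n) \<times> real" where
  "drift z = sqrt \<gamma> *\<^sub>R (A *v fst z, snd z)"

definition actuation :: "('n, 'k) policy \<Rightarrow> (real^'n) \<times> real \<Rightarrow> (real^'n) \<times> real" where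
  "actuation \<theta> z = sqrt \<gamma> *\<^sub>R (B *v feedback \<theta> z, 0)"

definition tracking_error :: "(real^'n) \<times> real \<Rightarrow> (real^'n) \<times> (real^'k)" where
  "tracking_error z = (fst z - snd z *\<^sub>R xstar, 0)"

definition control_output :: "('n, 'k) policy \<Rightarrow> (real^'n) \<times> real \<Rightarrow> (real^'n) \<times> (real^'k)" where
  "control_output \<theta> z = (0, feedback \<theta> z)"

lemma feedback_linear:
  "feedback \<theta> (x + y) = feedback \<theta> x + feedback \<theta> y" "feedback \<theta> (s *\<^sub>R x) = s *\<^sub>R feedback \<theta> x"
  "feedback (\<theta> + \<theta>') x = feedback \<theta> x + feedback \<theta>' x" "feedback (s *\<^sub>R \<theta>) x = s *\<^sub>R feedback \<theta> x"
  by (simp_all add: feedback_def matrix_vector_mult_add_rdistrib scaleR_add_right scaleR_add_left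
      matrix_vector_right_distrib matrix_vector_mult_scaleR mult.commute flip: scaleR_matrix_vector_assoc)

sublocale bilinear_feedback drift actuation tracking_error control_output form
proof (rule bilinear_feedback.intro)
  show "linear drift"
    by (rule linearI) (simp_all add: drift_def matrix_vector_right_distrib matrix_vector_mult_scaleR algebra_simps)
  show "linear tracking_error"
    by (rule linearI) (simp_all add: tracking_error_def algebra_simps)
  show "bounded_bilinear actuation"
    unfolding bilinear_conv_bounded_bilinear[symmetric] bilinear_def
    by (intro conjI allI linearI; simp add: actuation_def feedback_linear
      matrix_vector_right_distrib matrix_vector_mult_scaleR scaleR_add_right mult.commute)
  show "bounded_bilinear control_output"
    unfolding bilinear_conv_bounded_bilinear[symmetric] bilinear_def
    by (intro conjI allI linearI; simp add: control_output_def feedback_linear)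
  show "bounded_bilinear form"
    unfolding bilinear_conv_bounded_bilinear[symmetric] bilinear_def form_def
    by (auto intro!: linearI simp: matrix_vector_right_distrib matrix_vector_mult_scaleR inner_add_left inner_add_right
      algebra_simps)
  show "form u v = form v u" for u v
    using Q R by (simp add: form_def pos_def_def symmetric_form_commute[of Q "fst u"] symmetric_form_commute[of R "snd u"])
qed

lemma step_eq: "step \<theta> z = sqrt \<gamma> *\<^sub>R (A *v fst z + B *v feedback \<theta> z, snd z)"
  by (subst step_def) (simp add: drift_def actuation_def scaleR_add_right)

lemma out_eq: "out \<theta> z = (fst z - snd z *\<^sub>R xstar, feedback \<theta> z)"
  by (subst out_def) (simp add: tracking_error_def control_output_def)

lemma form_lower_bound:
  obtains q where "0 < q" "\<And>w. q * (norm w)\<^sup>2 \<le> form w w"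
proof -
  obtain s1 where s1: "0 < s1" "\<And>x. s1 * (norm x)\<^sup>2 \<le> x \<bullet> (Q *v x)" using pos_def_lower_bound[OF Q] by blast
  obtain s2 where s2: "0 < s2" "\<And>x. s2 * (norm x)\<^sup>2 \<le> x \<bullet> (R *v x)" using pos_def_lower_bound[OF R] by blast
  show thesis
  proof (rule that)
    show "0 < min s1 s2" using s1 s2 by simp
    fix w :: "(real^'n) \<times> (real^'k)"
    have "min s1 s2 * (norm (fst w))\<^sup>2 \<le> s1 * (norm (fst w))\<^sup>2" "min s1 s2 * (norm (snd w))\<^sup>2 \<le> s2 * (norm (snd w))\<^sup>2"
      by (auto intro!: mult_right_mono)
    then show "min s1 s2 * (norm w)\<^sup>2 \<le> form w w"
      using s1(2)[of "fst w"] s2(2)[of "snd w"] by (simp add: form_def norm_prod_def distrib_left)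
  qed
qed

lemma form_nonneg: "0 \<le> form w w"
  using form_lower_bound by (metis less_imp_le mult_nonneg_nonneg order_trans zero_le_power2)

lemma traj_eq: "traj \<theta> (x0, 1) t = sqrt \<gamma> ^ t *\<^sub>R (state A B xstar \<theta> x0 t, 1)"
proof (induction t)
  case (Suc t)
  then show ?case
    by (simp add: step_eq feedback_def matrix_vector_mult_scaleR
      control_def matrix_vector_right_distrib scaleR_add_right)
qed simp

lemma obs_eq: "obs \<theta> (x0, 1) t = sqrt \<gamma> ^ t *\<^sub>R
   (state A B xstar \<theta> x0 t - xstar, control xstar \<theta> (state A B xstar \<theta> x0 t))"
  by (simp add: obs_def traj_eq out_eq matrix_vector_mult_scaleR feedback_def control_def scaleR_diff_right scaleR_add_right)

lemma form_obs_eq: "form (obs \<theta> (x0, 1) t) (obs \<theta> (x0, 1) t) =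
   \<gamma> ^ t * stage_cost Q R xstar (state A B xstar \<theta> x0 t) (control xstar \<theta> (state A B xstar \<theta> x0 t))"
proof -
  have "sqrt \<gamma> ^ t * sqrt \<gamma> ^ t = \<gamma> ^ t" using \<gamma> by (simp flip: power_mult_distrib)
  then show ?thesis
    by (simp add: obs_eq form_def stage_cost_def matrix_vector_mult_scaleR algebra_simps flip: mult.assoc)
qed

lemma sample_cost_eq:
  "sample_cost A B Q R \<gamma> xstar \<theta> x0 = (\<Sum>t. ennreal (form (obs \<theta> (x0, 1) t) (obs \<theta> (x0, 1) t)))"
  by (simp add: sample_cost_def form_obs_eq)

lemma measurable_obs [measurable]: "(\<lambda>x0. obs \<theta> (x0, 1) t) \<in> borel_measurable borel"
proof (intro borel_measurable_continuous_onI)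
  have "continuous_on UNIV (\<lambda>z. obs \<theta> z t)"
    using linear_obs linear_conv_bounded_linear linear_continuous_on by blast
  then show "continuous_on UNIV (\<lambda>x0. obs \<theta> (x0, 1) t)"
    by (rule continuous_on_compose2) (auto intro!: continuous_intros)
qed

lemma measurable_form_obs [measurable]:
  "(\<lambda>x0. form (obs \<theta> (x0, 1) t) (obs \<theta> (x0, 1) t)) \<in> borel_measurable borel"
proof -
  have "continuous_on UNIV (\<lambda>w. form w w)"
    by (rule bounded_bilinear.continuous_on[OF b]) (auto intro: continuous_intros)
  from measurable_compose[OF measurable_obs borel_measurable_continuous_onI[OF this]]
  show ?thesis .
qed

definition mean_cost :: "(real^'n) measure \<Rightarrow> ('n, 'k) policy \<Rightarrow> real" where
  "mean_cost D \<theta> = (\<integral>x. cost \<theta> (x, 1) \<partial>D)"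

lemma sample_cost_eq_cost:
  assumes "summable (\<lambda>t. form (obs \<theta> (x0, 1) t) (obs \<theta> (x0, 1) t))"
  shows "sample_cost A B Q R \<gamma> xstar \<theta> x0 = ennreal (cost \<theta> (x0, 1))" and "0 \<le> cost \<theta> (x0, 1)"
  unfolding sample_cost_eq cost_def
  by (rule suminf_ennreal2[OF form_nonneg assms], rule suminf_nonneg[OF assms form_nonneg])

lemma expected_cost_eq_mean_cost:
  assumes D: "initial_distribution \<Sigma> D"
    and summable: "\<And>x. summable (\<lambda>t. form (obs \<theta> (x, 1) t) (obs \<theta> (x, 1) t))"
    and bound: "\<And>x. \<bar>cost \<theta> (x, 1)\<bar> \<le> K * (norm (x, 1::real))\<^sup>2"
  shows "integrable D (\<lambda>x. cost \<theta> (x, 1))"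
    and "expected_cost A B Q R \<gamma> xstar D \<theta> = ennreal (mean_cost D \<theta>)" and "0 \<le> mean_cost D \<theta>"
proof -
  interpret prob_space D using D by (simp add: initial_distribution_def)
  have sets [measurable_cong]: "sets D = sets borel" using D by (simp add: initial_distribution_def)
  show int: "integrable D (\<lambda>x. cost \<theta> (x, 1))"
  proof (rule Bochner_Integration.integrable_bound)
    show "integrable D (\<lambda>x. K * ((norm x)\<^sup>2 + 1))"
      using initial_distribution_moments(1)[OF D] by simp
    show "(\<lambda>x. cost \<theta> (x, 1)) \<in> borel_measurable D" unfolding cost_def by measurable
    show "AE x in D. norm (cost \<theta> (x, 1)) \<le> norm (K * ((norm x)\<^sup>2 + 1))"
    proof (rule AE_I2)
      fix x
      have "\<bar>cost \<theta> (x, 1)\<bar> \<le> K * ((norm x)\<^sup>2 + 1)" using bound[of x] by (simp add: norm_prod_def)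
      then show "norm (cost \<theta> (x, 1)) \<le> norm (K * ((norm x)\<^sup>2 + 1))"
        unfolding real_norm_def by (rule order_trans[OF _ abs_ge_self])
    qed
  qed
  have "sample_cost A B Q R \<gamma> xstar \<theta> = (\<lambda>x. ennreal (cost \<theta> (x, 1)))"
    using sample_cost_eq_cost(1)[OF summable] by (simp add: fun_eq_iff)
  then show "expected_cost A B Q R \<gamma> xstar D \<theta> = ennreal (mean_cost D \<theta>)"
    unfolding expected_cost_def mean_cost_def
    using nn_integral_eq_integral[OF int] sample_cost_eq_cost(2)[OF summable] by simp
  show "0 \<le> mean_cost D \<theta>"
    unfolding mean_cost_def using sample_cost_eq_cost(2)[OF summable] by (intro Bochner_Integration.integral_nonneg) simp
qed

text \<open>A bound on the expected cost bounds the closed loop uniformly. Every output is a linear image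
  of \<open>(x0, 1)\<close>, so the expected cost dominates the sum of the squared operator norms of these
  maps. The term at time \<open>0\<close> bounds the output map, that is, the gains as far as they
  matter. The state is the first output component plus \<open>s *\<^sub>R xstar\<close>, and the second summand is square summable because of the
  discount; hence the trajectories are square summable with a uniform constant, and the Lyapunov
  argument applies.\<close>

lemma sublevel_uniformly_stable:
  assumes \<Sigma>: "pos_def \<Sigma>" and C: "0 < C"
  obtains c a \<eta> where "0 < c" "0 \<le> a" "a < 1" "0 \<le> \<eta>"
    "\<And>D \<theta>. initial_distribution \<Sigma> D \<Longrightarrow> \<theta> \<in> sublevel A B Q R \<gamma> xstar D C \<Longrightarrow> tame c a \<eta> \<theta>"
proof -
  obtain q where q: "0 < q" "\<And>w. q * (norm w)\<^sup>2 \<le> form w w" using form_lower_bound by blast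
  obtain s where s: "0 < s" "\<And>x. s * (norm x)\<^sup>2 \<le> x \<bullet> (\<Sigma> *v x)" using pos_def_lower_bound[OF \<Sigma>] by blast
  define \<mu> where "\<mu> = min s 1"
  have \<mu>: "0 < \<mu>" "\<mu> \<le> 1" "\<mu> * (norm l)\<^sup>2 \<le> l \<bullet> (\<Sigma> *v l)" for l
    using s order_trans[OF mult_right_mono[of \<mu> s "(norm l)\<^sup>2"] s(2)] by (auto simp: \<mu>_def)
  define E where "E = C / (q * \<mu>)"
  define c where "c = 1 + 2 * E + (2 * (norm xstar)\<^sup>2 + 1) / (1 - \<gamma>)"
  have E: "0 < E" using C q \<mu> by (simp add: E_def)
  have c: "1 < c" unfolding c_def using E \<gamma> by (smt (verit) divide_nonneg_pos zero_le_power2)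
  show thesis
  proof (rule that[of "sqrt c" "sqrt (1 - 1 / c)" "sqrt E"])
    fix D \<theta>
    assume D: "initial_distribution \<Sigma> D" and \<theta>: "\<theta> \<in> sublevel A B Q R \<gamma> xstar D C"
    note mom = linear_image_second_moment[OF D linear_obs \<mu>, of \<theta>]
    have part_int: "(\<Sum>t<n. q * (\<integral>x. (norm (obs \<theta> (x, 1) t))\<^sup>2 \<partial>D)) \<le> C" for n
    proof -
      have "ennreal (\<Sum>t<n. q * (\<integral>x. (norm (obs \<theta> (x, 1) t))\<^sup>2 \<partial>D))
          = ennreal (\<integral>x. (\<Sum>t<n. q * (norm (obs \<theta> (x, 1) t))\<^sup>2) \<partial>D)"
        using mom(1) by (simp add: Bochner_Integration.integral_sum)
      also have "\<dots> = (\<integral>\<^sup>+x. ennreal (\<Sum>t<n. q * (norm (obs \<theta> (x, 1) t))\<^sup>2) \<partial>D)"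
        using mom(1) q by (intro nn_integral_eq_integral[symmetric]) (auto intro!: sum_nonneg)
      also have "\<dots> \<le> (\<integral>\<^sup>+x. sample_cost A B Q R \<gamma> xstar \<theta> x \<partial>D)"
      proof (rule nn_integral_mono)
        fix x
        have "ennreal (\<Sum>t<n. q * (norm (obs \<theta> (x, 1) t))\<^sup>2)
            \<le> ennreal (\<Sum>t<n. form (obs \<theta> (x, 1) t) (obs \<theta> (x, 1) t))"
          by (intro ennreal_leI sum_mono q)
        also have "\<dots> = (\<Sum>t<n. ennreal (form (obs \<theta> (x, 1) t) (obs \<theta> (x, 1) t)))"
          by (simp add: sum_ennreal form_nonneg)
        also have "\<dots> \<le> sample_cost A B Q R \<gamma> xstar \<theta> x"
          unfolding sample_cost_eq by (rule sum_le_suminf) auto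
        finally show "ennreal (\<Sum>t<n. q * (norm (obs \<theta> (x, 1) t))\<^sup>2) \<le> sample_cost A B Q R \<gamma> xstar \<theta> x" .
      qed
      also have "\<dots> \<le> ennreal C" using \<theta> by (simp add: sublevel_def expected_cost_def)
      finally show ?thesis using C by (simp add: ennreal_le_iff)
    qed
    have part: "(\<Sum>t<n. (norm (obs \<theta> z t))\<^sup>2) \<le> E * (norm z)\<^sup>2" for n z
    proof -
      have "q * \<mu> * (\<Sum>t<n. (norm (obs \<theta> z t))\<^sup>2) = (\<Sum>t<n. q * (\<mu> * (norm (obs \<theta> z t))\<^sup>2))"
        by (simp add: sum_distrib_left mult.assoc)
      also have "\<dots> \<le> (\<Sum>t<n. q * ((norm z)\<^sup>2 * (\<integral>x. (norm (obs \<theta> (x, 1) t))\<^sup>2 \<partial>D)))"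
        using q by (intro sum_mono mult_left_mono mom(2)) auto
      also have "\<dots> = (norm z)\<^sup>2 * (\<Sum>t<n. q * (\<integral>x. (norm (obs \<theta> (x, 1) t))\<^sup>2 \<partial>D))"
        by (simp add: sum_distrib_left mult_ac)
      also have "\<dots> \<le> (norm z)\<^sup>2 * C" by (intro mult_left_mono part_int) auto
      finally show ?thesis using q \<mu> by (simp add: E_def field_simps)
    qed
    have out: "norm (out \<theta> z) \<le> sqrt E * norm z" for z
    proof (rule power2_le_imp_le)
      show "(norm (out \<theta> z))\<^sup>2 \<le> (sqrt E * norm z)\<^sup>2"
        using part[of z 1] E by (simp add: obs_def power_mult_distrib)
    qed (use E in simp)
    have snd_traj: "snd (traj \<theta> z t) = sqrt \<gamma> ^ t * snd z" for z t
      by (induction t) (simp_all add: step_eq)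
    have traj_le: "(norm (traj \<theta> z t))\<^sup>2 \<le> 2 * (norm (obs \<theta> z t))\<^sup>2 + \<gamma> ^ t * ((2 * (norm xstar)\<^sup>2 + 1) * (norm z)\<^sup>2)" for z t
    proof -
      define x y where "x = fst (traj \<theta> z t)" and "y = snd (traj \<theta> z t)"
      have "norm x \<le> norm (x - y *\<^sub>R xstar) + norm (y *\<^sub>R xstar)"
        using norm_triangle_sub[of x "y *\<^sub>R xstar"] by (simp add: add.commute)
      then have "(norm x)\<^sup>2 \<le> (norm (x - y *\<^sub>R xstar) + norm (y *\<^sub>R xstar))\<^sup>2"
        by (intro power_mono) auto
      also have "\<dots> \<le> 2 * (norm (x - y *\<^sub>R xstar))\<^sup>2 + 2 * (norm (y *\<^sub>R xstar))\<^sup>2"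
        using sum_squares_bound[of "norm (x - y *\<^sub>R xstar)" "norm (y *\<^sub>R xstar)"]
        by (simp add: power2_sum)
      finally have 1: "(norm x)\<^sup>2 \<le> 2 * (norm (x - y *\<^sub>R xstar))\<^sup>2 + 2 * (norm xstar)\<^sup>2 * y\<^sup>2"
        by (simp add: power_mult_distrib mult_ac)
      have "norm (x - y *\<^sub>R xstar) \<le> norm (obs \<theta> z t)"
        unfolding obs_def out_eq x_def y_def by (rule norm_fst_le)
      then have 2: "(norm (x - y *\<^sub>R xstar))\<^sup>2 \<le> (norm (obs \<theta> z t))\<^sup>2" by (intro power_mono) auto
      have "y\<^sup>2 = \<gamma> ^ t * (snd z)\<^sup>2"
        using \<gamma> by (simp add: y_def snd_traj power_mult_distrib flip: power_mult)
           (metis mult.commute power_mult less_imp_le real_sqrt_pow2)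
      also have "\<dots> \<le> \<gamma> ^ t * (norm z)\<^sup>2"
        using \<gamma> by (intro mult_left_mono) (auto simp: norm_prod_def)
      finally have "y\<^sup>2 * (2 * (norm xstar)\<^sup>2 + 1) \<le> \<gamma> ^ t * (norm z)\<^sup>2 * (2 * (norm xstar)\<^sup>2 + 1)"
        by (rule mult_right_mono) simp
      then have "2 * (norm xstar)\<^sup>2 * y\<^sup>2 + y\<^sup>2 \<le> \<gamma> ^ t * ((2 * (norm xstar)\<^sup>2 + 1) * (norm z)\<^sup>2)"
        by (simp add: algebra_simps)
      moreover have "(norm (traj \<theta> z t))\<^sup>2 = (norm x)\<^sup>2 + y\<^sup>2" by (simp add: norm_prod_def x_def y_def)
      ultimately show ?thesis using 1 2 by linarith
    qed
    have "(\<Sum>t<n. (norm (traj \<theta> z t))\<^sup>2) \<le> c * (norm z)\<^sup>2" for n z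
    proof -
      let ?X = "(2 * (norm xstar)\<^sup>2 + 1) * (norm z)\<^sup>2"
      have "(\<Sum>t<n. (norm (traj \<theta> z t))\<^sup>2) \<le> (\<Sum>t<n. 2 * (norm (obs \<theta> z t))\<^sup>2 + \<gamma> ^ t * ?X)"
        by (intro sum_mono traj_le)
      also have "\<dots> = 2 * (\<Sum>t<n. (norm (obs \<theta> z t))\<^sup>2) + (\<Sum>t<n. \<gamma> ^ t) * ?X"
        by (simp only: sum.distrib sum_distrib_left sum_distrib_right)
      also have "\<dots> \<le> 2 * (E * (norm z)\<^sup>2) + 1 / (1 - \<gamma>) * ?X"
      proof (intro add_mono mult_left_mono part mult_right_mono)
        show "(\<Sum>t<n. \<gamma> ^ t) \<le> 1 / (1 - \<gamma>)"
          using \<gamma> by (simp add: sum_gp_strict divide_right_mono)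
      qed auto
      also have "\<dots> \<le> c * (norm z)\<^sup>2" by (simp add: c_def algebra_simps add_divide_distrib)
      finally show ?thesis .
    qed
    then show "tame (sqrt c) (sqrt (1 - 1 / c)) (sqrt E) \<theta>"
      using exponential_stability_of_square_summable[of c \<theta>] c out by (simp add: tame_def)
  qed (use c E in auto)
qed

end

section \<open>Local Lipschitz bounds for cost and gradient\<close>

theorem proposition2:
  fixes A Q \<Sigma> :: "real^'n^'n"
    and B :: "real^'k^'n"
    and R :: "real^'k^'k"
    and xstar :: "real^'n"
    and \<gamma> C C\<^sub>n :: real
  assumes "controllable A B"
    and "pos_def Q" and "pos_def R" and "pos_def \<Sigma>"
    and "0 < \<gamma>" and "\<gamma> < 1"
    and "C > 0" and "C\<^sub>n > 0"
  shows "\<exists>\<rho>>0. \<exists>lam>0. \<exists>L>0. \<forall>D.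
    initial_distribution \<Sigma> D \<and> (\<forall>x0\<in>msupport D. norm x0 \<le> C\<^sub>n) \<longrightarrow>
    (\<forall>\<theta>\<in>sublevel A B Q R \<gamma> xstar D C. \<forall>\<theta>'. norm (\<theta>' - \<theta>) \<le> \<rho> \<longrightarrow>
      expected_cost A B Q R \<gamma> xstar D \<theta> < \<infinity> \<and>
      expected_cost A B Q R \<gamma> xstar D \<theta>' < \<infinity> \<and>
      \<bar>enn2real (expected_cost A B Q R \<gamma> xstar D \<theta>') - enn2real (expected_cost A B Q R \<gamma> xstar D \<theta>)\<bar>
        \<le> lam * norm (\<theta>' - \<theta>) \<and>
      (\<forall>x0\<in>msupport D.
        sample_cost A B Q R \<gamma> xstar \<theta> x0 < \<infinity> \<and>
        sample_cost A B Q R \<gamma> xstar \<theta>' x0 < \<infinity> \<and>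
        \<bar>enn2real (sample_cost A B Q R \<gamma> xstar \<theta>' x0) - enn2real (sample_cost A B Q R \<gamma> xstar \<theta> x0)\<bar>
          \<le> lam * norm (\<theta>' - \<theta>)) \<and>
      (\<exists>g g'.
        GDERIV (\<lambda>\<eta>. enn2real (expected_cost A B Q R \<gamma> xstar D \<eta>)) \<theta> :> g \<and>
        GDERIV (\<lambda>\<eta>. enn2real (expected_cost A B Q R \<gamma> xstar D \<eta>)) \<theta>' :> g' \<and>
        norm (g' - g) \<le> L * norm (\<theta>' - \<theta>)))"
proof -
  interpret discounted_lqr A Q B R xstar \<gamma>
    using assms by unfold_locales
  obtain c a \<eta> where ca: "0 < c" "0 \<le> a" "a < 1" "0 \<le> \<eta>"
    and sub: "\<And>D \<theta>. initial_distribution \<Sigma> D \<Longrightarrow> \<theta> \<in> sublevel A B Q R \<gamma> xstar D C \<Longrightarrow> tame c a \<eta> \<theta>"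
  proof (rule sublevel_uniformly_stable[OF assms(4,7)], goal_cases)
    case 1 show thesis by (rule 1(1)[OF 1(2-)])
  qed
  obtain r a' \<eta>' where r: "0 < r" and a': "0 \<le> a'" "a' < 1" "0 \<le> \<eta>'"
    and nbh: "\<And>\<theta> \<theta>'. tame c a \<eta> \<theta> \<Longrightarrow> norm (\<theta>' - \<theta>) \<le> r \<Longrightarrow> tame c a' \<eta>' \<theta>'"
  proof (rule uniformly_stable_neighbourhood[OF ca(2,3,1,4)], goal_cases)
    case 1 show thesis by (rule 1(1)[OF 1(2-)])
  qed
  obtain K where K: "0 < K" and expand:
    "\<And>\<theta> \<theta>' z. tame c a' \<eta>' \<theta> \<Longrightarrow> tame c a' \<eta>' \<theta>' \<Longrightarrow>
      summable (\<lambda>t. form (obs \<theta> z t) (obs \<theta> z t)) \<and>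
      \<bar>cost \<theta> z\<bar> \<le> K * (norm z)\<^sup>2 \<and>
      linear (dcost \<theta> z) \<and>
      \<bar>cost \<theta>' z - cost \<theta> z\<bar> \<le> K * norm (\<theta>' - \<theta>) * (norm z)\<^sup>2 \<and>
      \<bar>cost \<theta>' z - cost \<theta> z - dcost \<theta> z (\<theta>' - \<theta>)\<bar> \<le> K * (norm (\<theta>' - \<theta>))\<^sup>2 * (norm z)\<^sup>2"
  proof (rule uniform_first_order_expansion[OF a'(1,2) ca(1) a'(3)], goal_cases)
    case 1 show thesis by (rule 1(1)[OF 1(2-)])
  qed
  define T where "T = \<bar>trace \<Sigma>\<bar>"
  define lam where "lam = K * (1 + C\<^sub>n\<^sup>2 + T)"
  define L where "L = 6 * (K * (1 + T))"
  \<comment> \<open>half of the radius, because the two gradients are compared at points at distance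
    \<open>norm (\<theta>' - \<theta>)\<close> from \<open>\<theta>'\<close>, which may be twice as far from \<open>\<theta>\<close>\<close>
  have pos: "0 < r / 2" "0 < lam" "0 < L"
    using r K by (auto simp: lam_def L_def T_def intro!: mult_pos_pos add_pos_nonneg)
  show ?thesis
  proof (rule exI, rule conjI[OF pos(1)], rule exI, rule conjI[OF pos(2)], rule exI,
      rule conjI[OF pos(3)], intro allI impI ballI, goal_cases)
    case (1 D \<theta> \<theta>')
    then have D: "initial_distribution \<Sigma> D" and supp: "\<forall>x0\<in>msupport D. norm x0 \<le> C\<^sub>n"
      and \<theta>: "\<theta> \<in> sublevel A B Q R \<gamma> xstar D C" and \<theta>': "norm (\<theta>' - \<theta>) \<le> r / 2"
      by blast+
    interpret prob_space D using D by (simp add: initial_distribution_def)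
    have good: "tame c a' \<eta>' y" if "y \<in> cball \<theta> r" for y
      using nbh[of \<theta> y] sub[OF D \<theta>] that by (simp add: dist_norm norm_minus_commute)
    have expand': "summable (\<lambda>t. form (obs y z t) (obs y z t)) \<and> \<bar>cost y z\<bar> \<le> K * (norm z)\<^sup>2 \<and>
      linear (dcost y z) \<and> \<bar>cost y' z - cost y z\<bar> \<le> K * norm (y' - y) * (norm z)\<^sup>2 \<and>
      \<bar>cost y' z - cost y z - dcost y z (y' - y)\<bar> \<le> K * (norm (y' - y))\<^sup>2 * (norm z)\<^sup>2"
      if "y \<in> cball \<theta> r" "y' \<in> cball \<theta> r" for y y' z
      using expand[of y y' z] good[OF that(1)] good[OF that(2)] by blast
    have \<theta>_in: "\<theta> \<in> cball \<theta> r" "\<theta>' \<in> cball \<theta> r"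
      using r \<theta>' by (auto simp: dist_norm norm_minus_commute)
    have \<theta>'_ball: "y \<in> cball \<theta> r" if "y \<in> cball \<theta>' (r / 2)" for y
      using that \<theta>' dist_triangle[of \<theta> y \<theta>'] by (simp add: dist_norm norm_minus_commute)
    let ?m = "\<lambda>x::real^'n. (norm (x, 1::real))\<^sup>2"
    have m_eq: "?m = (\<lambda>x. (norm x)\<^sup>2 + 1)" by (simp add: norm_prod_def)
    have m_int: "integrable D ?m" and m_val: "integral\<^sup>L D ?m \<le> 1 + T"
      unfolding m_eq using initial_distribution_moments(1,2)[OF D] by (simp_all add: prob_space T_def)
    have regular: "summable (\<lambda>t. form (obs y z t) (obs y z t))" "\<bar>cost y z\<bar> \<le> K * (norm z)\<^sup>2"
      if "y \<in> cball \<theta> r" for y z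
      using expand'[OF that that] by blast+
    have sample: "sample_cost A B Q R \<gamma> xstar y x = ennreal (cost y (x, 1))" "0 \<le> cost y (x, 1)"
      and expected: "expected_cost A B Q R \<gamma> xstar D y = ennreal (mean_cost D y)" "0 \<le> mean_cost D y"
      and int: "integrable D (\<lambda>x. cost y (x, 1))"
      if "y \<in> cball \<theta> r" for y x
      using sample_cost_eq_cost[OF regular(1)] expected_cost_eq_mean_cost[OF D regular] that by blast+
    let ?J = "mean_cost D"
    have J_lip: "\<bar>?J \<theta>' - ?J \<theta>\<bar> \<le> K * norm (\<theta>' - \<theta>) * (1 + T)"
    proof -
      have "\<bar>?J \<theta>' - ?J \<theta>\<bar> = \<bar>\<integral>x. cost \<theta>' (x, 1) - cost \<theta> (x, 1) \<partial>D\<bar>"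
        unfolding mean_cost_def using int[OF \<theta>_in(1)] int[OF \<theta>_in(2)] by simp
      also have "\<dots> \<le> (\<integral>x. \<bar>cost \<theta>' (x, 1) - cost \<theta> (x, 1)\<bar> \<partial>D)" by (rule integral_abs_bound)
      also have "\<dots> \<le> (\<integral>x. K * norm (\<theta>' - \<theta>) * ?m x \<partial>D)"
        using int[OF \<theta>_in(1)] int[OF \<theta>_in(2)] m_int expand'[OF \<theta>_in] by (intro integral_mono) auto
      also have "\<dots> = K * norm (\<theta>' - \<theta>) * integral\<^sup>L D ?m" by simp
      also have "\<dots> \<le> K * norm (\<theta>' - \<theta>) * (1 + T)" by (rule mult_left_mono[OF m_val]) (use K in simp)
      finally show ?thesis .
    qed
    have taylor: "\<exists>g. \<forall>z \<in> cball y s. \<bar>?J z - ?J y - g \<bullet> (z - y)\<bar> \<le> K * (1 + T) * (norm (z - y))\<^sup>2"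
      if y: "y \<in> cball \<theta> r" and s: "0 < s" "cball y s \<subseteq> cball \<theta> r" for y s
    proof -
      obtain g where g: "\<And>z. z \<in> cball y s \<Longrightarrow>
          \<bar>?J z - ?J y - g \<bullet> (z - y)\<bar> \<le> K * (norm (z - y))\<^sup>2 * integral\<^sup>L D ?m"
        unfolding mean_cost_def
      proof (rule taylor_expansion_integral[OF s(1) m_int])
        show "integrable D (\<lambda>x. cost z (x, 1))" if "z \<in> cball y s" for z using int that s by blast
        show "linear (dcost y (x, 1))" for x using expand'[OF y y] by blast
        show "\<bar>cost z (x, 1) - cost y (x, 1) - dcost y (x, 1) (z - y)\<bar> \<le> K * (norm (z - y))\<^sup>2 * ?m x"
          if "z \<in> cball y s" for x z using expand'[OF y, of z] that s by blast
      qed blast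
      have "K * (norm (z - y))\<^sup>2 * integral\<^sup>L D ?m \<le> K * (1 + T) * (norm (z - y))\<^sup>2" for z
        using mult_left_mono[OF m_val, of "K * (norm (z - y))\<^sup>2"] K by (simp add: mult_ac)
      then show ?thesis using g order_trans by blast
    qed
    obtain g where g: "\<And>z. z \<in> cball \<theta> r \<Longrightarrow> \<bar>?J z - ?J \<theta> - g \<bullet> (z - \<theta>)\<bar> \<le> K * (1 + T) * (norm (z - \<theta>))\<^sup>2"
      using taylor[OF \<theta>_in(1) r] by blast
    obtain g' where g': "\<And>z. z \<in> cball \<theta>' (r / 2) \<Longrightarrow>
        \<bar>?J z - ?J \<theta>' - g' \<bullet> (z - \<theta>')\<bar> \<le> K * (1 + T) * (norm (z - \<theta>'))\<^sup>2"
      using taylor[OF \<theta>_in(2) pos(1)] \<theta>'_ball by blast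
    have Je: "enn2real (expected_cost A B Q R \<gamma> xstar D y) = ?J y" if "y \<in> cball \<theta> r" for y
      using expected[OF that] by simp
    have grad: "GDERIV (\<lambda>\<eta>. enn2real (expected_cost A B Q R \<gamma> xstar D \<eta>)) \<theta> :> g"
      using g \<theta>_in Je by (intro GDERIV_of_quadratic_remainder[OF r, where K = "K * (1 + T)"]) simp
    have grad': "GDERIV (\<lambda>\<eta>. enn2real (expected_cost A B Q R \<gamma> xstar D \<eta>)) \<theta>' :> g'"
      using g' \<theta>_in \<theta>'_ball Je
      by (intro GDERIV_of_quadratic_remainder[OF pos(1), where K = "K * (1 + T)"]) simp
    have grad_lip: "norm (g' - g) \<le> L * norm (\<theta>' - \<theta>)"
      using gradient_difference_of_quadratic_remainder[OF \<theta>' g g'] K r by (simp add: L_def T_def)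
    have "K * norm (\<theta>' - \<theta>) * (1 + T) \<le> lam * norm (\<theta>' - \<theta>)"
      using K by (simp add: lam_def algebra_simps)
    then have "\<bar>?J \<theta>' - ?J \<theta>\<bar> \<le> lam * norm (\<theta>' - \<theta>)"
      using J_lip by linarith
    moreover have "\<bar>cost \<theta>' (x, 1) - cost \<theta> (x, 1)\<bar> \<le> lam * norm (\<theta>' - \<theta>)" if "x \<in> msupport D" for x
    proof -
      have "(norm x)\<^sup>2 \<le> C\<^sub>n\<^sup>2" using supp that by (intro power_mono) auto
      then have "?m x \<le> 1 + C\<^sub>n\<^sup>2 + T" by (simp add: norm_prod_def T_def)
      then have "K * norm (\<theta>' - \<theta>) * ?m x \<le> K * norm (\<theta>' - \<theta>) * (1 + C\<^sub>n\<^sup>2 + T)"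
        by (rule mult_left_mono) (use K in simp)
      then have "K * norm (\<theta>' - \<theta>) * ?m x \<le> lam * norm (\<theta>' - \<theta>)" by (simp add: lam_def mult_ac)
      then show ?thesis using expand'[OF \<theta>_in] order_trans by blast
    qed
    moreover have "\<exists>g g'.
        GDERIV (\<lambda>\<eta>. enn2real (expected_cost A B Q R \<gamma> xstar D \<eta>)) \<theta> :> g \<and>
        GDERIV (\<lambda>\<eta>. enn2real (expected_cost A B Q R \<gamma> xstar D \<eta>)) \<theta>' :> g' \<and>
        norm (g' - g) \<le> L * norm (\<theta>' - \<theta>)"
      using grad grad' grad_lip by blast
    ultimately show ?case
      using sample[OF \<theta>_in(1)] sample[OF \<theta>_in(2)] expected[OF \<theta>_in(1)] expected[OF \<theta>_in(2)]
      by (intro conjI ballI; (assumption | simp))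
  qed
qed

end
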